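(* If $T$ is a subcubic tree, then $\gamma(T)=\gamma_e(T)$ if and only if $T\in\mathcal{T}$.
   Context: All graphs are finite, simple and undirected; subcubic means maximum degree at most $3$; an endvertex is a vertex of degree at most $1$; $P_1$ is the one-vertex graph. $\gamma(G)$ is the domination number of $G$; a minimum dominating set is a dominating set of size $\gamma(G)$. For $X\subseteq V(G)$, $\gamma(G,X)$ is the minimum size of a set $D\subseteq V(G)$ such that every vertex of $X\setminus D$ has a neighbor in $D$. For $D\subseteq V(G)$ and vertices $u,v$, $\mathrm{dist}_{(G,D)}(u,v)$ is the minimum number of edges of a path $P$ in $G$ between $u$ and $v$ such that $D$ contains exactly one endvertex of $P$ and no internal vertex of $P$ ($\infty$ if none; $\mathrm{dist}_{(G,D)}(u,u)=0$ for $u\in D$); $w_{(G,D)}(u)=\sum_{v\in D}\left(\frac12\right)^{\mathrm{dist}_{(G,D)}(u,v)-1}$ with $\left(\frac12\right)^\infty=0$. $D$ is an exponential dominating set if $w_{(G,D)}(u)\ge1$ for all $u\in V(G)$; $\gamma_e(G)$ is the minimum size of such a set. For a graph $G$ and vertex $x$, $\tau_G(x)$ is the minimum real $\tau$ such that there exists $D\subseteq V(G)$ with $|D|<\gamma_e(G)$, $x\notin D$, and $w_{(G,D)}(u)+\left(\frac12\right)^{\mathrm{dist}_{G-D}(x,u)}\tau\ge 1$ for every $u\in V(G)\setminus D$ (here $\mathrm{dist}_{G-D}$ is the usual distance in $G-D$). Operations on trees, producing a tree $T$ from a tree $T'$: Operation 1: $T$ has an endvertex $y$ with neighbor $x$ such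 that $T'=T-y$ and $x$ belongs to some minimum dominating set of $T'$. Operation 2: $T$ contains a path $xyz$ where $y$ has degree $2$ in $T$, $z$ is an endvertex of $T$, $T'=T-\{y,z\}$, and $\tau_{T'}(x)>1$ or $\gamma(T',V(T')\setminus\{x\})<\gamma(T')$. Operation 3: $T$ contains a path $wxyz$ where $x$ and $y$ have degree $2$ in $T$, $z$ is an endvertex of $T$, $T'=T-\{x,y,z\}$, and $\tau_{T'}(w)>\frac12$. $\mathcal{T}$ is the family of subcubic trees obtained from $P_1$ by applying finite sequences of Operations 1, 2, 3. *)

theory Defs
  imports Complex_Main "HOL-Library.Extended_Nat"
begin

definition graph :: "'a set \<Rightarrow> 'a set set \<Rightarrow> bool" where
  "graph V E \<longleftrightarrow> finite V \<and> E \<subseteq> {{u, v} | u v. u \<in> V \<and> v \<in> V \<and> u \<noteq> v}"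

definition degree :: "'a set \<Rightarrow> 'a set set \<Rightarrow> 'a \<Rightarrow> nat" where
  "degree V E v = card {u \<in> V. {v, u} \<in> E}"

definition subcubic :: "'a set \<Rightarrow> 'a set set \<Rightarrow> bool" where
  "subcubic V E \<longleftrightarrow> (\<forall>v\<in>V. degree V E v \<le> 3)"

definition endvertex :: "'a set \<Rightarrow> 'a set set \<Rightarrow> 'a \<Rightarrow> bool" where
  "endvertex V E v \<longleftrightarrow> v \<in> V \<and> degree V E v \<le> 1"

definition is_path :: "'a set \<Rightarrow> 'a set set \<Rightarrow> 'a list \<Rightarrow> bool" where
  "is_path V E xs \<longleftrightarrow> xs \<noteq> [] \<and> distinct xs \<and> set xs \<subseteq> V \<and>
     (\<forall>i. Suc i < length xs \<longrightarrow> {xs ! i, xs ! Suc i} \<in> E)"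

definition is_cycle :: "'a set \<Rightarrow> 'a set set \<Rightarrow> 'a list \<Rightarrow> bool" where
  "is_cycle V E xs \<longleftrightarrow> is_path V E xs \<and> length xs \<ge> 3 \<and> {last xs, hd xs} \<in> E"

definition connected_graph :: "'a set \<Rightarrow> 'a set set \<Rightarrow> bool" where
  "connected_graph V E \<longleftrightarrow>
     (\<forall>u\<in>V. \<forall>v\<in>V. \<exists>xs. is_path V E xs \<and> hd xs = u \<and> last xs = v)"

definition tree :: "'a set \<Rightarrow> 'a set set \<Rightarrow> bool" where
  "tree V E \<longleftrightarrow> graph V E \<and> V \<noteq> {} \<and> connected_graph V E \<and> (\<nexists>xs. is_cycle V E xs)"

definition del_V :: "'a set \<Rightarrow> 'a set \<Rightarrow> 'a set" where
  "del_V V S = V - S"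

definition del_E :: "'a set set \<Rightarrow> 'a set \<Rightarrow> 'a set set" where
  "del_E E S = {e \<in> E. e \<inter> S = {}}"

definition dominates_set :: "'a set \<Rightarrow> 'a set set \<Rightarrow> 'a set \<Rightarrow> 'a set \<Rightarrow> bool" where
  "dominates_set V E X D \<longleftrightarrow> D \<subseteq> V \<and> (\<forall>x\<in>X - D. \<exists>d\<in>D. {x, d} \<in> E)"

definition dominating :: "'a set \<Rightarrow> 'a set set \<Rightarrow> 'a set \<Rightarrow> bool" where
  "dominating V E D \<longleftrightarrow> dominates_set V E V D"

definition gamma :: "'a set \<Rightarrow> 'a set set \<Rightarrow> nat" where
  "gamma V E = Min {card D | D. dominating V E D}"

definition gamma_rel :: "'a set \<Rightarrow> 'a set set \<Rightarrow> 'a set \<Rightarrow> nat" where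
  "gamma_rel V E X = Min {card D | D. dominates_set V E X D}"

definition min_dominating :: "'a set \<Rightarrow> 'a set set \<Rightarrow> 'a set \<Rightarrow> bool" where
  "min_dominating V E D \<longleftrightarrow> dominating V E D \<and> card D = gamma V E"

text \<open>Distances (as extended naturals; infinity if no path).\<close>
definition dist_G :: "'a set \<Rightarrow> 'a set set \<Rightarrow> 'a \<Rightarrow> 'a \<Rightarrow> enat" where
  "dist_G V E u v = Inf {enat (length xs - 1) | xs. is_path V E xs \<and> hd xs = u \<and> last xs = v}"

definition dist_GD :: "'a set \<Rightarrow> 'a set set \<Rightarrow> 'a set \<Rightarrow> 'a \<Rightarrow> 'a \<Rightarrow> enat" where
  "dist_GD V E D u v =
     (if u = v \<and> u \<in> D then 0
      else Inf {enat (length xs - 1) | xs. is_path V E xs \<and> hd xs = u \<and> last xs = v \<and>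
                  ((hd xs \<in> D) \<noteq> (last xs \<in> D)) \<and>
                  (\<forall>i. 0 < i \<and> Suc i < length xs \<longrightarrow> xs ! i \<notin> D)})"

definition half_pow :: "enat \<Rightarrow> real" where
  "half_pow d = (case d of enat n \<Rightarrow> (1/2) ^ n | \<infinity> \<Rightarrow> 0)"

text \<open>w_(G,D)(u) = sum over v in D of (1/2)^(dist - 1) = 2 * (1/2)^dist.\<close>
definition weight :: "'a set \<Rightarrow> 'a set set \<Rightarrow> 'a set \<Rightarrow> 'a \<Rightarrow> real" where
  "weight V E D u = (\<Sum>v\<in>D. 2 * half_pow (dist_GD V E D u v))"

definition exp_dominating :: "'a set \<Rightarrow> 'a set set \<Rightarrow> 'a set \<Rightarrow> bool" where
  "exp_dominating V E D \<longleftrightarrow> D \<subseteq> V \<and> (\<forall>u\<in>V. weight V E D u \<ge> 1)"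

definition gamma_e :: "'a set \<Rightarrow> 'a set set \<Rightarrow> nat" where
  "gamma_e V E = Min {card D | D. exp_dominating V E D}"

definition tau :: "'a set \<Rightarrow> 'a set set \<Rightarrow> 'a \<Rightarrow> real" where
  "tau V E x = Inf {t. \<exists>D. D \<subseteq> V \<and> card D < gamma_e V E \<and> x \<notin> D \<and>
      (\<forall>u\<in>V - D. weight V E D u +
          half_pow (dist_G (del_V V D) (del_E E D) x u) * t \<ge> 1)}"

definition op1 :: "'a set \<Rightarrow> 'a set set \<Rightarrow> 'a set \<Rightarrow> 'a set set \<Rightarrow> bool" where
  "op1 V E V' E' \<longleftrightarrow> (\<exists>x y. endvertex V E y \<and> {x, y} \<in> E \<and>
      V' = del_V V {y} \<and> E' = del_E E {y} \<and>
      (\<exists>D. min_dominating V' E' D \<and> x \<in> D))"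

definition op2 :: "'a set \<Rightarrow> 'a set set \<Rightarrow> 'a set \<Rightarrow> 'a set set \<Rightarrow> bool" where
  "op2 V E V' E' \<longleftrightarrow> (\<exists>x y z. is_path V E [x, y, z] \<and> degree V E y = 2 \<and> endvertex V E z \<and>
      V' = del_V V {y, z} \<and> E' = del_E E {y, z} \<and>
      (tau V' E' x > 1 \<or> gamma_rel V' E' (V' - {x}) < gamma V' E'))"

definition op3 :: "'a set \<Rightarrow> 'a set set \<Rightarrow> 'a set \<Rightarrow> 'a set set \<Rightarrow> bool" where
  "op3 V E V' E' \<longleftrightarrow> (\<exists>w x y z. is_path V E [w, x, y, z] \<and> degree V E x = 2 \<and>
      degree V E y = 2 \<and> endvertex V E z \<and>
      V' = del_V V {x, y, z} \<and> E' = del_E E {x, y, z} \<and> tau V' E' w > 1/2)"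

inductive famT :: "'a set \<Rightarrow> 'a set set \<Rightarrow> bool" where
  base: "famT {v} {}"
| step: "\<lbrakk> tree V E; subcubic V E; famT V' E';
          op1 V E V' E' \<or> op2 V E V' E' \<or> op3 V E V' E' \<rbrakk> \<Longrightarrow> famT V E"

end

(* Subcubicity makes the weight monotone in D: a new member p of D blocks only walks that pass
   through p, whose total weight is at most the weight of p (Kraft's inequality). Hence members of D
   can be moved from a pendant part to its vertex of attachment, or from a leaf to its neighbour,
   gamma_e does not increase when a pendant part is deleted, and a vertex chosen on the pendant path
   acts on the rest of the tree exactly as the term in the definition of tau. So each operation
   preserves equality. Conversely, the operations can be undone at the end of a longest path, because
   gamma then drops by at least as much as gamma_e can. *)

theory Submission
  imports Defs
begin

section \<open>Walks and the weight function\<close>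

text \<open>Halving per step is matched to degree 3: a vertex reached by a shortest walk has at most
  two edges leading further on, so the weights behind it add up to at most its own. The obstacle is
  that members of \<open>D\<close> block walks, so enlarging \<open>D\<close> can destroy
  contributions. The same blocking helps when the attachment vertex itself is chosen, because then
  nothing crosses between the two sides. The bounds 1 and 1/2 in Operations 2 and 3 are
  \<open>2 * (1/2) ^ c\<close>, where \<open>c\<close> is 1 or 2, the distance from the attachment
  vertex to the neighbour \<open>y\<close> of the leaf: this is the strength with which
  \<open>y\<close> acts on the rest. Write \<open>gamma'\<close> and \<open>gamma_e'\<close> for the
  tree without the pendant path. Always \<open>gamma_e' \<le> gamma_e \<le> gamma_e' + 1\<close>,
  and the tau condition says exactly that the upper bound is attained. It thus gives
  \<open>gamma \<le> gamma' + 1 = gamma_e' + 1 = gamma_e \<le> gamma\<close>. For the converse,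
  \<open>gamma' + 1 \<le> gamma\<close> gives \<open>gamma' + 1 \<le> gamma = gamma_e \<le> gamma_e'
  + 1 \<le> gamma' + 1\<close>; equality throughout yields both the equality for the smaller tree
  and the tau condition.\<close>

definition first_decay :: "(nat \<Rightarrow> bool) \<Rightarrow> real" where
  "first_decay P = (if \<exists>n. P n then (1/2) ^ (LEAST n. P n) else 0)"

lemma first_decay_nonneg: "first_decay P \<ge> 0"
  by (simp add: first_decay_def)

lemma first_decay_pos: "P n \<Longrightarrow> first_decay P > 0"
  by (auto simp: first_decay_def)

lemma first_decay_ge: "P n \<Longrightarrow> (1/2) ^ n \<le> first_decay P"
  by (auto simp: first_decay_def intro!: power_decreasing Least_le)

lemma first_decay_le:
  assumes "\<And>n. P n \<Longrightarrow> k \<le> n"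
  shows "first_decay P \<le> (1/2) ^ k"
proof (cases "\<exists>n. P n")
  case True
  then have "P (LEAST n. P n)" by (auto intro: LeastI)
  then show ?thesis using True by (auto simp: first_decay_def intro!: power_decreasing assms)
qed (auto simp: first_decay_def)

lemma first_decay_eq:
  assumes "P n" "\<And>m. P m \<Longrightarrow> n \<le> m"
  shows "first_decay P = (1/2) ^ n"
  using assms by (meson antisym first_decay_ge first_decay_le)

lemma first_decay_shift_le:
  assumes "\<And>n. P n \<Longrightarrow> \<exists>m. m + k \<le> n \<and> Q m"
  shows "first_decay P \<le> first_decay Q * (1/2) ^ k"
proof (cases "\<exists>n. P n")
  case True
  then have "P (LEAST n. P n)" by (auto intro: LeastI)
  then obtain m where m: "m + k \<le> (LEAST n. P n)" "Q m" using assms by blast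
  have "first_decay P = (1/2) ^ (LEAST n. P n)"
    using True by (auto simp: first_decay_def)
  also have "\<dots> \<le> (1/2) ^ (m + k)" using m(1) by (intro power_decreasing) auto
  also have "\<dots> \<le> first_decay Q * (1/2) ^ k"
    using first_decay_ge[of Q, OF m(2)] by (simp add: power_add)
  finally show ?thesis .
qed (auto simp: first_decay_def)

lemma first_decay_mono:
  assumes "\<And>n. P n \<Longrightarrow> \<exists>m\<le>n. Q m"
  shows "first_decay P \<le> first_decay Q"
  using first_decay_shift_le[of P 0 Q] assms by auto

text \<open>Meant for targets behind a cut vertex: \<open>Q\<close> stands for arrival at the cut
  vertex, \<open>P\<close> for arrival at the target, and \<open>k\<close> for the steps between
  them, so that the decay factorises.\<close>

lemma first_decay_shift:
  assumes "\<And>n. P n \<Longrightarrow> \<exists>m. m + k \<le> n \<and> Q m" "\<And>m. Q m \<Longrightarrow> P (m + k)"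
  shows "first_decay P = first_decay Q * (1/2) ^ k"
proof (rule antisym)
  show "first_decay Q * (1/2) ^ k \<le> first_decay P"
  proof (cases "\<exists>n. Q n")
    case True
    then have "Q (LEAST n. Q n)" by (auto intro: LeastI)
    from first_decay_ge[of P, OF assms(2)[OF this]] True show ?thesis
      by (simp add: first_decay_def[of Q] power_add)
  next
    case False
    then show ?thesis using first_decay_nonneg[of P] by (simp add: first_decay_def[of Q])
  qed
qed (rule first_decay_shift_le[OF assms(1)])

lemma half_pow_Inf: "half_pow (Inf {enat n | n. P n}) = first_decay P"
proof (cases "\<exists>n. P n")
  case True
  have "Inf {enat n | n. P n} = enat (LEAST n. P n)"
    by (rule antisym)
      (use True in \<open>auto intro!: Inf_lower Inf_greatest intro: LeastI Least_le\<close>)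
  then show ?thesis using True by (simp add: half_pow_def first_decay_def)
next
  case False
  \<comment> \<open>The infimum of the empty set is \<open>top\<close>, that is, infinity;
    \<open>half_pow\<close> sends it to 0, the default value of \<open>first_decay\<close>.\<close>
  then show ?thesis
    by (simp add: half_pow_def first_decay_def top_enat_def[symmetric]) (simp add: top_enat_def)
qed

text \<open>Walks replace the paths of the definitions: only the last vertex of a walk counted by
  \<open>reach\<close> may lie in \<open>D\<close>, and shortest walks are paths.\<close>

primrec reach :: "'a set set \<Rightarrow> 'a set \<Rightarrow> 'a \<Rightarrow> nat \<Rightarrow> 'a set" where
  "reach E D u 0 = {u}"
| "reach E D u (Suc n) = {v. \<exists>x\<in>reach E D u n - D. {x, v} \<in> E}"

text \<open>For \<open>u\<close> outside \<open>D\<close> this covers both distances of the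
  statement: a target in \<open>D\<close> gives the one of \<open>dist_GD\<close>, a target outside
  \<open>D\<close> the distance in the graph without \<open>D\<close>.\<close>

definition decay :: "'a set set \<Rightarrow> 'a set \<Rightarrow> 'a \<Rightarrow> 'a \<Rightarrow> real" where
  "decay E D u v = first_decay (\<lambda>n. v \<in> reach E D u n)"

lemma edge_in_V: "graph V E \<Longrightarrow> {x, y} \<in> E \<Longrightarrow> x \<in> V \<and> y \<in> V \<and> x \<noteq> y"
  by (fastforce simp: graph_def doubleton_eq_iff)

lemma reach_subset: "graph V E \<Longrightarrow> u \<in> V \<Longrightarrow> reach E D u n \<subseteq> V"
  by (cases n) (auto dest: edge_in_V)

lemma path_imp_reach:
  assumes "is_path V E xs" "\<forall>i. Suc i < length xs \<longrightarrow> xs ! i \<notin> D" "i < length xs"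
  shows "xs ! i \<in> reach E D (hd xs) i"
  using assms(3)
proof (induction i)
  case 0
  then show ?case by (simp add: hd_conv_nth)
next
  case (Suc i)
  then show ?case using assms(1,2) unfolding is_path_def by force
qed

lemma reach_imp_path:
  assumes "graph V E" "u \<in> V" "v \<in> reach E D u n" "\<And>m. v \<in> reach E D u m \<Longrightarrow> n \<le> m"
  shows "\<exists>xs. is_path V E xs \<and> hd xs = u \<and> last xs = v \<and> length xs = Suc n \<and>
    (\<forall>i<n. xs ! i \<notin> D)"
proof -
  have "\<exists>xs. is_path V E xs \<and> hd xs = u \<and> last xs = v \<and> length xs = Suc n \<and>
    (\<forall>i<n. xs ! i \<notin> D) \<and> (\<forall>i\<le>n. \<forall>m. xs ! i \<in> reach E D u m \<longrightarrow> i \<le> m)"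
    using assms(3,4)
  proof (induction n arbitrary: v)
    case 0
    then show ?case using assms(2) by (intro exI[of _ "[u]"]) (auto simp: is_path_def)
  next
    case (Suc n)
    then obtain x where x: "x \<in> reach E D u n" "x \<notin> D" "{x, v} \<in> E" by auto
    have minx: "n \<le> m" if "x \<in> reach E D u m" for m
      using Suc.prems(2)[of "Suc m"] that x by auto
    obtain xs where xs: "is_path V E xs" "hd xs = u" "last xs = x" "length xs = Suc n"
      "\<forall>i<n. xs ! i \<notin> D" "\<forall>i\<le>n. \<forall>m. xs ! i \<in> reach E D u m \<longrightarrow> i \<le> m"
      using Suc.IH[OF x(1) minx] by blast
    have xn: "xs ! n = x" using xs(3,4) by (metis diff_Suc_1 last_conv_nth length_0_conv nat.simps(3))
    \<comment> \<open>A repetition of \<open>v\<close> at position \<open>i\<close> would be a walk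
      to \<open>v\<close> of length \<open>i \<le> n\<close>, against the minimality of
      \<open>Suc n\<close>.\<close>
    have "v \<notin> set xs"
    proof
      assume "v \<in> set xs"
      then obtain i where i: "i \<le> n" "xs ! i = v" by (metis in_set_conv_nth less_Suc_eq_le xs(4))
      have "v \<in> reach E D u i"
      proof -
        have "\<forall>i. Suc i < length xs \<longrightarrow> xs ! i \<notin> D" using xs(4,5) by auto
        from path_imp_reach[OF xs(1) this, of i] show ?thesis using i xs(2,4) by auto
      qed
      then show False using Suc.prems(2) i(1) by fastforce
    qed
    moreover have "v \<in> V" using edge_in_V[OF assms(1) x(3)] by blast
    ultimately have "is_path V E (xs @ [v])"
      using xs(1,4) x(3) xn by (auto simp: is_path_def nth_append less_Suc_eq)
    moreover have "\<forall>i<Suc n. (xs @ [v]) ! i \<notin> D"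
      using xs(4,5) x(2) xn by (auto simp: nth_append less_Suc_eq)
    moreover have "\<forall>i\<le>Suc n. \<forall>m. (xs @ [v]) ! i \<in> reach E D u m \<longrightarrow> i \<le> m"
      using xs(4,6) Suc.prems(2) by (auto simp: nth_append le_Suc_eq)
    moreover have "hd (xs @ [v]) = u" using xs(2,4) by (cases xs) auto
    ultimately show ?case using xs(4) by (intro exI[of _ "xs @ [v]"]) auto
  qed
  then show ?thesis by blast
qed

lemma half_pow_Inf_paths:
  assumes "graph V E" "u \<in> V"
  shows "half_pow (Inf {enat (length xs - 1) | xs. is_path V E xs \<and> hd xs = u \<and> last xs = v \<and>
     (\<forall>i. Suc i < length xs \<longrightarrow> xs ! i \<notin> D)}) = decay E D u v"
proof -
  let ?P = "\<lambda>n. \<exists>xs. is_path V E xs \<and> hd xs = u \<and> last xs = v \<and>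
     (\<forall>i. Suc i < length xs \<longrightarrow> xs ! i \<notin> D) \<and> length xs = Suc n"
  have "{enat (length xs - 1) | xs. is_path V E xs \<and> hd xs = u \<and> last xs = v \<and>
     (\<forall>i. Suc i < length xs \<longrightarrow> xs ! i \<notin> D)} = {enat n | n. ?P n}"
  proof (intro equalityI subsetI; clarify)
    fix xs assume "is_path V E xs" "\<forall>i. Suc i < length xs \<longrightarrow> xs ! i \<notin> D" "u = hd xs" "v = last xs"
    moreover from this have "length xs = Suc (length xs - 1)" by (cases xs) (auto simp: is_path_def)
    ultimately show "\<exists>n. enat (length xs - 1) = enat n \<and>
        (\<exists>ys. is_path V E ys \<and> hd ys = hd xs \<and> last ys = last xs \<and>
              (\<forall>i. Suc i < length ys \<longrightarrow> ys ! i \<notin> D) \<and> length ys = Suc n)"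
      by blast
  next
    fix n xs assume "is_path V E xs" "\<forall>i. Suc i < length xs \<longrightarrow> xs ! i \<notin> D" "u = hd xs" "v = last xs"
      "length xs = Suc n"
    then show "\<exists>ys. enat n = enat (length ys - 1) \<and> is_path V E ys \<and> hd ys = hd xs \<and>
       last ys = last xs \<and> (\<forall>i. Suc i < length ys \<longrightarrow> ys ! i \<notin> D)"
      by (intro exI[of _ xs]) auto
  qed
  moreover have "first_decay ?P = decay E D u v"
    unfolding decay_def
  proof (rule antisym; rule first_decay_mono)
    fix n assume "?P n"
    then obtain xs where xs: "is_path V E xs" "hd xs = u" "last xs = v"
     "\<forall>i. Suc i < length xs \<longrightarrow> xs ! i \<notin> D" "length xs = Suc n" by blast
    have "xs ! n \<in> reach E D u n" using path_imp_reach[OF xs(1,4), of n] xs(2,5) by simp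
    moreover have "xs ! n = v" using xs(3,5) by (metis diff_Suc_1 last_conv_nth length_0_conv nat.simps(3))
    ultimately show "\<exists>m\<le>n. v \<in> reach E D u m" by blast
  next
    fix n assume *: "v \<in> reach E D u n"
    \<comment> \<open>Only a shortest walk is known to be a path, so the given walk is replaced by
      one of minimal length.\<close>
    define m where "m = (LEAST m. v \<in> reach E D u m)"
    have "v \<in> reach E D u m" "m \<le> n" unfolding m_def using * by (auto intro: LeastI Least_le)
    moreover have "m \<le> k" if "v \<in> reach E D u k" for k unfolding m_def using that by (rule Least_le)
    ultimately show "\<exists>m\<le>n. ?P m" using reach_imp_path[OF assms, of v D m] by fastforce
  qed
  ultimately show ?thesis by (simp add: half_pow_Inf)
qed

text \<open>A path from \<open>u\<close> to another member of \<open>D\<close> has both ends in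
  \<open>D\<close> and does not count; what remains is the term \<open>v = u\<close>, which is
  \<open>2 * (1/2) ^ 0\<close>.\<close>

lemma weight_in:
  assumes "finite D" "u \<in> D"
  shows "weight V E D u = 2"
proof -
  have "2 * half_pow (dist_GD V E D u v) = (if v = u then 2 else 0)" if "v \<in> D" for v
  proof (cases "v = u")
    case False
    then have "dist_GD V E D u v = \<infinity>"
      using assms(2) that
      by (auto simp: dist_GD_def top_enat_def[symmetric] intro!: Inf_eqI)
    then show ?thesis using False by (simp add: half_pow_def)
  qed (use assms in \<open>simp add: dist_GD_def half_pow_def zero_enat_def\<close>)
  then show ?thesis using assms by (simp add: weight_def sum.If_cases Int_absorb1)
qed

text \<open>With \<open>u\<close> outside and \<open>v\<close> inside \<open>D\<close>, the
  condition on the two ends is automatic and position 0 avoids \<open>D\<close> as well, so the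
  restriction to internal vertices becomes one on all vertices but the last.\<close>

lemma weight_out:
  assumes "graph V E" "u \<in> V" "u \<notin> D"
  shows "weight V E D u = (\<Sum>v\<in>D. 2 * decay E D u v)"
  unfolding weight_def
proof (intro sum.cong refl)
  fix v assume v: "v \<in> D"
  have "{enat (length xs - 1) | xs. is_path V E xs \<and> hd xs = u \<and> last xs = v \<and>
                  ((hd xs \<in> D) \<noteq> (last xs \<in> D)) \<and>
                  (\<forall>i. 0 < i \<and> Suc i < length xs \<longrightarrow> xs ! i \<notin> D)}
     = {enat (length xs - 1) | xs. is_path V E xs \<and> hd xs = u \<and> last xs = v \<and>
     (\<forall>i. Suc i < length xs \<longrightarrow> xs ! i \<notin> D)}"
  proof (rule arg_cong[where f = Collect], intro ext ex_cong1 conj_cong refl)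
    fix xs assume *: "is_path V E xs" "hd xs = u" "last xs = v"
    then have 0: "xs ! 0 = u" by (simp add: is_path_def hd_conv_nth)
    show "((hd xs \<in> D) \<noteq> (last xs \<in> D) \<and> (\<forall>i. 0 < i \<and> Suc i < length xs \<longrightarrow> xs ! i \<notin> D))
      = (\<forall>i. Suc i < length xs \<longrightarrow> xs ! i \<notin> D)"
      using * v assms(3) 0 by (metis gr0I)
  qed
  then show "2 * half_pow (dist_GD V E D u v) = 2 * decay E D u v"
    using half_pow_Inf_paths[OF assms(1,2), of v D] assms(3) by (auto simp: dist_GD_def)
qed

lemma is_path_rev: "is_path V E (rev xs) = is_path V E xs"
proof -
  have "is_path V E (rev xs)" if "is_path V E xs" for xs
    unfolding is_path_def
  proof (intro conjI allI impI)
    fix i assume i: "Suc i < length (rev xs)"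
    then have "rev xs ! i = xs ! Suc (length xs - Suc (Suc i))"
      "rev xs ! Suc i = xs ! (length xs - Suc (Suc i))"
      by (auto simp: rev_nth Suc_diff_Suc)
    moreover have "{xs ! (length xs - Suc (Suc i)), xs ! Suc (length xs - Suc (Suc i))} \<in> E"
      using that i by (auto simp: is_path_def)
    ultimately show "{rev xs ! i, rev xs ! Suc i} \<in> E" by (simp add: insert_commute)
  qed (use that in \<open>auto simp: is_path_def\<close>)
  from this[of xs] this[of "rev xs"] show ?thesis by auto
qed

text \<open>Paths are read backwards, from \<open>u\<close> to \<open>x\<close>. Since
  \<open>x\<close> lies outside \<open>D\<close>, avoiding \<open>D\<close> before the last vertex
  is the same as avoiding it altogether.\<close>

lemma half_pow_dist_G_del:
  assumes "graph V E" "u \<in> V" "u \<notin> D" "x \<notin> D"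
  shows "half_pow (dist_G (del_V V D) (del_E E D) x u) = decay E D u x"
proof -
  have eq: "is_path (del_V V D) (del_E E D) xs \<and> hd xs = x \<and> last xs = u \<longleftrightarrow>
    is_path V E (rev xs) \<and> hd (rev xs) = u \<and> last (rev xs) = x \<and>
     (\<forall>i. Suc i < length (rev xs) \<longrightarrow> rev xs ! i \<notin> D)" for xs
  proof (cases "xs = []")
    case False
    have set_iff: "(\<forall>i. Suc i < length (rev xs) \<longrightarrow> rev xs ! i \<notin> D) \<longleftrightarrow> set xs \<inter> D = {}"
      if "last (rev xs) = x"
    proof
      assume *: "\<forall>i. Suc i < length (rev xs) \<longrightarrow> rev xs ! i \<notin> D"
      have "rev xs ! i \<notin> D" if "i < length xs" for i
      proof (cases "Suc i < length xs")
        case False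
        then have "i = length xs - 1" using that by simp
        then show ?thesis using \<open>last (rev xs) = x\<close> assms(4) \<open>xs \<noteq> []\<close>
          by (metis last_conv_nth length_rev rev_is_Nil_conv)
      qed (use * in auto)
      then show "set xs \<inter> D = {}" by (metis disjoint_iff in_set_conv_nth length_rev set_rev)
    next
      assume "set xs \<inter> D = {}"
      then show "\<forall>i. Suc i < length (rev xs) \<longrightarrow> rev xs ! i \<notin> D"
        by (metis Suc_lessD disjoint_iff nth_mem set_rev)
    qed
    have "is_path (del_V V D) (del_E E D) xs \<longleftrightarrow> is_path V E xs \<and> set xs \<inter> D = {}"
    proof
      assume "is_path (del_V V D) (del_E E D) xs"
      then show "is_path V E xs \<and> set xs \<inter> D = {}"
        by (auto simp: is_path_def del_V_def del_E_def)
    next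
      assume *: "is_path V E xs \<and> set xs \<inter> D = {}"
      then have "xs ! i \<notin> D" if "i < length xs" for i using that nth_mem by blast
      with * show "is_path (del_V V D) (del_E E D) xs"
        by (auto simp: is_path_def del_V_def del_E_def)
    qed
    then show ?thesis using set_iff is_path_rev[of V E xs] False by (auto simp: hd_rev last_rev)
  qed (simp add: is_path_def)
  have "{enat (length xs - 1) | xs. is_path (del_V V D) (del_E E D) xs \<and> hd xs = x \<and> last xs = u}
    = {enat (length xs - 1) | xs. is_path V E xs \<and> hd xs = u \<and> last xs = x \<and>
     (\<forall>i. Suc i < length xs \<longrightarrow> xs ! i \<notin> D)}" (is "?A = ?B")
  proof
    show "?A \<subseteq> ?B" unfolding eq by (clarify) (metis length_rev)
    show "?B \<subseteq> ?A"
    proof clarify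
      fix xs assume "is_path V E xs" "u = hd xs" "x = last xs" "\<forall>i. Suc i < length xs \<longrightarrow> xs ! i \<notin> D"
      then show "\<exists>ys. enat (length xs - 1) = enat (length ys - 1) \<and>
         is_path (del_V V D) (del_E E D) ys \<and> hd ys = last xs \<and> last ys = hd xs"
        using eq[of "rev xs"] by (intro exI[of _ "rev xs"]) auto
    qed
  qed
  then show ?thesis using half_pow_Inf_paths[OF assms(1,2), of x D] by (simp add: dist_G_def)
qed

lemma decay_nonneg: "decay E D u v \<ge> 0"
  by (simp add: decay_def first_decay_nonneg)

section \<open>Monotonicity of the weight, and parts attached at one vertex\<close>

lemma neighbours_finite: "graph V E \<Longrightarrow> finite {v. {x, v} \<in> E}"
  by (rule finite_subset[of _ V]) (auto dest: edge_in_V, simp add: graph_def)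

lemma subcubic_neighbours:
  assumes "graph V E" "subcubic V E" "x \<in> V"
  shows "card {v. {x, v} \<in> E} \<le> 3"
proof -
  have "{v. {x, v} \<in> E} = {u \<in> V. {x, u} \<in> E}" using assms(1) by (auto dest: edge_in_V)
  then show ?thesis using assms by (simp add: subcubic_def degree_def)
qed

text \<open>When \<open>p\<close> joins \<open>D\<close>, a vertex \<open>u\<close> loses only targets in \<open>D\<close> that it reached through
  \<open>p\<close>. The layers \<open>S m\<close> of vertices behind \<open>p\<close> satisfy a Kraft inequality, since every
  vertex in them spends one of its three edges on going back towards \<open>u\<close>; so the loss is at most
  the gain from \<open>p\<close>.\<close>

lemma weight_insert:
  assumes G: "graph V E" and C: "subcubic V E" and D: "D \<subseteq> V"
    and u: "u \<in> V" "u \<notin> D" "u \<noteq> p" and p: "p \<in> V" "p \<notin> D"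
  shows "(\<Sum>v\<in>D. decay E D u v) \<le> (\<Sum>v\<in>insert p D. decay E (insert p D) u v)"
proof -
  define R where "R = reach E D u"
  define R' where "R' = reach E (insert p D) u"
  have finV: "finite V" using G by (simp add: graph_def)
  have finD: "finite D" using D finV finite_subset by blast
  have R'_sub: "R' n \<subseteq> R n" for n
    unfolding R_def R'_def by (induction n) auto
  have RV: "R n \<subseteq> V" for n
    unfolding R_def using reach_subset[OF G u(1)] .
  define lev where "lev v n \<longleftrightarrow> v \<in> R n \<and> (\<forall>m. v \<in> R m \<longrightarrow> n \<le> m)" for v n
  have lev_unique: "lev v n \<Longrightarrow> lev v m \<Longrightarrow> n = m" for v n m
    by (auto simp: lev_def intro: antisym)
  have lev_exists: "\<exists>n. lev v n" if "v \<in> R k" for v k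
    unfolding lev_def using LeastI[of "\<lambda>n. v \<in> R n", OF that] Least_le[of "\<lambda>n. v \<in> R n"] by blast
  have lev_decay: "decay E D u v = (1/2) ^ n" if "lev v n" for v n
    using that unfolding lev_def decay_def R_def[symmetric] by (intro first_decay_eq) auto
  \<comment> \<open>The last clause locates damage: a predecessor other than \<open>p\<close> that
    is still reached at its level passes this on to \<open>v\<close>. So if \<open>v\<close> is
    lost, its predecessor is lost too or is \<open>p\<close>.\<close>
  have lev_pred: "\<exists>x. lev x n \<and> x \<notin> D \<and> {x, v} \<in> E \<and> (v \<notin> R' (Suc n) \<longrightarrow> x \<in> R' n \<longrightarrow> x = p)"
    if "lev v (Suc n)" for v n
  proof -
    from that obtain x where x: "x \<in> R n" "x \<notin> D" "{x, v} \<in> E" by (auto simp: lev_def R_def)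
    have "n \<le> m" if "x \<in> R m" for m
    proof -
      have "v \<in> R (Suc m)" using that x by (auto simp: R_def)
      then show ?thesis using \<open>lev v (Suc n)\<close> by (force simp: lev_def)
    qed
    moreover have "v \<in> R' (Suc n)" if "x \<in> R' n" "x \<noteq> p" using that x by (auto simp: R'_def)
    ultimately show ?thesis using x by (auto simp: lev_def)
  qed
  show ?thesis
  proof (cases "\<exists>k. p \<in> R k")
    case False
    have "R' n = R n" for n
    proof (induction n)
      case (Suc n)
      have "p \<notin> R n" using False by blast
      then show ?case using Suc by (auto simp: R_def R'_def)
    qed (simp add: R_def R'_def)
    then have "decay E (insert p D) u v = decay E D u v" for v
      by (simp add: decay_def R_def R'_def)
    then show ?thesis using p finD by (simp add: decay_nonneg)
  next
    case True
    then obtain d where d: "lev p d" using lev_exists by blast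
    \<comment> \<open>Putting \<open>p\<close> into \<open>D\<close> stops only walks that have
      already arrived at \<open>p\<close>, so nothing changes up to and including level
      \<open>d\<close>.\<close>
    have below: "R' j = R j" if "j \<le> d" for j
      using that
    proof (induction j)
      case (Suc j)
      have "p \<notin> R j" using d Suc.prems by (force simp: lev_def)
      then show ?case using Suc by (auto simp: R_def R'_def)
    qed (simp add: R_def R'_def)
    have d0: "d > 0" using d u(3) by (cases d) (auto simp: lev_def R_def)
    \<comment> \<open>Besides \<open>p\<close>, these are the vertices of level \<open>m\<close> all
      of whose shortest walks from \<open>u\<close> run through \<open>p\<close>.\<close>
    define S where "S m = {v. lev v m \<and> (v = p \<or> v \<notin> R' m)}" for m
    have SV: "S m \<subseteq> V" for m using RV by (auto simp: S_def lev_def)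
    then have finS: "finite (S m)" for m using finV finite_subset by blast
    have Sd: "S d = {p}" using d below[of d] by (auto simp: S_def lev_def)
    \<comment> \<open>One of the three edges at \<open>x\<close> leads back to level
      \<open>m - 1\<close>. This fails for \<open>u\<close> itself, whence \<open>m > 0\<close>; the
      layers used start at \<open>d > 0\<close>.\<close>
    have children: "card {v. {x, v} \<in> E \<and> lev v (Suc m)} \<le> 2" if x: "lev x m" "m > 0" for x m
    proof -
      obtain k where k: "m = Suc k" using x(2) by (cases m) auto
      obtain y where y: "lev y k" "{y, x} \<in> E" using lev_pred x(1) k by blast
      have xV: "x \<in> V" using x(1) RV by (auto simp: lev_def)
      have "{v. {x, v} \<in> E \<and> lev v (Suc m)} \<subseteq> {v. {x, v} \<in> E} - {y}"
        using y(1) k lev_unique[of y k "Suc m"] by auto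
      then have "card {v. {x, v} \<in> E \<and> lev v (Suc m)} \<le> card ({v. {x, v} \<in> E} - {y})"
        using neighbours_finite[OF G] by (intro card_mono) auto
      also have "\<dots> = card {v. {x, v} \<in> E} - 1"
        using y(2) neighbours_finite[OF G] by (simp add: insert_commute)
      also have "\<dots> \<le> 2" using subcubic_neighbours[OF G C xV] by simp
      finally show ?thesis .
    qed
    have step: "card (S (Suc m)) \<le> 2 * card (S m - D)" if m: "d \<le> m" for m
    proof -
      have "S (Suc m) \<subseteq> (\<Union>x\<in>S m - D. {v. {x, v} \<in> E \<and> lev v (Suc m)})"
      proof
        fix v assume v: "v \<in> S (Suc m)"
        then have "v \<noteq> p" using d m lev_unique[of p d "Suc m"] by (auto simp: S_def)
        then have v': "lev v (Suc m)" "v \<notin> R' (Suc m)" using v by (auto simp: S_def)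
        obtain x where x: "lev x m" "x \<notin> D" "{x, v} \<in> E" "x \<in> R' m \<longrightarrow> x = p"
          using lev_pred[OF v'(1)] v'(2) by blast
        then show "v \<in> (\<Union>x\<in>S m - D. {v. {x, v} \<in> E \<and> lev v (Suc m)})"
          using v'(1) by (auto simp: S_def)
      qed
      then have "card (S (Suc m)) \<le> card (\<Union>x\<in>S m - D. {v. {x, v} \<in> E \<and> lev v (Suc m)})"
        using finS neighbours_finite[OF G] by (intro card_mono) auto
      also have "\<dots> \<le> (\<Sum>x\<in>S m - D. card {v. {x, v} \<in> E \<and> lev v (Suc m)})"
        using finS by (intro card_UN_le) auto
      also have "\<dots> \<le> (\<Sum>x\<in>S m - D. 2)"
        using children m d0 by (intro sum_mono) (auto simp: S_def)
      finally show ?thesis by simp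
    qed
    \<comment> \<open>Invariant of the layers: members of \<open>D\<close> keep their weight for
      good, every other vertex passes its weight on to at most two children of half the weight. The
      second summand is the weight still in transit.\<close>
    have kraft: "(\<Sum>m=d..d+n. real (card (S m \<inter> D)) * (1/2) ^ m)
        + real (card (S (d + n) - D)) * (1/2) ^ (d + n) \<le> (1/2) ^ d" for n
    proof (induction n)
      case 0
      have "S d \<inter> D = {}" "S d - D = {p}" using Sd p by auto
      then show ?case by simp
    next
      case (Suc n)
      have "real (card (S (Suc (d + n)) \<inter> D)) + real (card (S (Suc (d + n)) - D))
          = real (card (S (Suc (d + n))))"
        using finS by (metis of_nat_add card_Int_Diff)
      also have "\<dots> \<le> 2 * real (card (S (d + n) - D))" using step[of "d + n"] by linarith
      finally have "(real (card (S (Suc (d + n)) \<inter> D)) + real (card (S (Suc (d + n)) - D)))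
          * (1/2) ^ Suc (d + n) \<le> 2 * real (card (S (d + n) - D)) * (1/2) ^ Suc (d + n)"
        by (intro mult_right_mono) auto
      then show ?case using Suc by (simp add: algebra_simps)
    qed
    define B where "B = {v \<in> D. \<exists>m\<ge>d. v \<in> S m}"
    have finB: "finite B" using finD by (simp add: B_def)
    \<comment> \<open>\<open>B\<close> collects the targets that may be lost. Being finite, it lies
      within finitely many layers, so a partial sum of \<open>kraft\<close> covers it.\<close>
    have "\<exists>N. \<forall>v\<in>B. \<forall>m. lev v m \<longrightarrow> m \<le> d + N"
    proof -
      have "\<forall>v\<in>B. \<exists>m. lev v m" by (auto simp: B_def S_def)
      then obtain f where f: "\<And>v. v \<in> B \<Longrightarrow> lev v (f v)" by metis
      have "m \<le> d + (\<Sum>v\<in>B. f v)" if v: "v \<in> B" "lev v m" for v m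
      proof -
        have "m = f v" using f v lev_unique by blast
        then show ?thesis using member_le_sum[of v B f] v finB by simp
      qed
      then show ?thesis by blast
    qed
    then obtain N where N: "\<And>v m. v \<in> B \<Longrightarrow> lev v m \<Longrightarrow> m \<le> d + N" by blast
    have B_UN: "B = (\<Union>m\<in>{d..d+N}. S m \<inter> D)"
      using N by (fastforce simp: B_def S_def)
    have "(\<Sum>v\<in>B. decay E D u v) = (\<Sum>m=d..d+N. \<Sum>v\<in>S m \<inter> D. decay E D u v)"
      unfolding B_UN using finS lev_unique
      by (intro sum.UNION_disjoint) (auto simp: S_def)
    also have "\<dots> = (\<Sum>m=d..d+N. real (card (S m \<inter> D)) * (1/2) ^ m)"
    proof (intro sum.cong refl)
      fix m
      have "(\<Sum>v\<in>S m \<inter> D. decay E D u v) = (\<Sum>v\<in>S m \<inter> D. (1/2) ^ m)"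
        by (intro sum.cong refl) (auto simp: S_def lev_decay)
      then show "(\<Sum>v\<in>S m \<inter> D. decay E D u v) = real (card (S m \<inter> D)) * (1/2) ^ m"
        by simp
    qed
    also have "\<dots> \<le> (1/2) ^ d"
      using kraft[of N] by (smt (verit) mult_nonneg_nonneg of_nat_0_le_iff zero_le_power divide_nonneg_nonneg)
    also have "\<dots> \<le> decay E (insert p D) u p"
      unfolding decay_def using d below[of d]
      by (intro first_decay_ge) (auto simp: lev_def R'_def)
    finally have bad: "(\<Sum>v\<in>B. decay E D u v) \<le> decay E (insert p D) u p" .
    have good: "decay E D u v \<le> decay E (insert p D) u v" if v: "v \<in> D - B" for v
    proof (cases "\<exists>n. lev v n")
      case True
      then obtain n where n: "lev v n" by blast
      have "v \<in> R' n"
      proof (cases "n \<le> d")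
        case False
        then show ?thesis using v n by (auto simp: B_def S_def)
      qed (use n below in \<open>auto simp: lev_def\<close>)
      then show ?thesis
        using first_decay_ge[of "\<lambda>n. v \<in> R' n" n] lev_decay[OF n]
        by (simp add: decay_def R'_def)
    next
      case False
      then have "\<nexists>n. v \<in> R n" using lev_exists by blast
      then have "decay E D u v = 0" by (auto simp: decay_def first_decay_def R_def)
      then show ?thesis by (simp add: decay_nonneg)
    qed
    have "(\<Sum>v\<in>D. decay E D u v) = (\<Sum>v\<in>D - B. decay E D u v) + (\<Sum>v\<in>B. decay E D u v)"
      using finD by (intro sum.subset_diff) (auto simp: B_def)
    also have "\<dots> \<le> (\<Sum>v\<in>D - B. decay E (insert p D) u v) + decay E (insert p D) u p"
      using bad good by (intro add_mono sum_mono) auto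
    also have "\<dots> \<le> (\<Sum>v\<in>D. decay E (insert p D) u v) + decay E (insert p D) u p"
      using finD by (intro add_mono sum_mono2 order_refl) (auto simp: decay_nonneg)
    finally show ?thesis using finD p by simp
  qed
qed

lemma exp_dominating_iff:
  assumes "graph V E"
  shows "exp_dominating V E D \<longleftrightarrow> D \<subseteq> V \<and> (\<forall>u\<in>V - D. (\<Sum>v\<in>D. 2 * decay E D u v) \<ge> 1)"
proof -
  have "finite D" if "D \<subseteq> V" using that assms finite_subset by (auto simp: graph_def)
  then have "weight V E D u \<ge> 1 \<longleftrightarrow> u \<in> D \<or> (\<Sum>v\<in>D. 2 * decay E D u v) \<ge> 1"
    if "D \<subseteq> V" "u \<in> V" for u
    using that weight_in[of D u V E] weight_out[OF assms, of u D] by (cases "u \<in> D") auto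
  then show ?thesis by (auto simp: exp_dominating_def)
qed

lemma exp_dominating_insert:
  assumes "graph V E" "subcubic V E" "exp_dominating V E D" "p \<in> V"
  shows "exp_dominating V E (insert p D)"
proof (cases "p \<in> D")
  case False
  have "(\<Sum>v\<in>insert p D. 2 * decay E (insert p D) u v) \<ge> 1" if "u \<in> V - insert p D" for u
  proof -
    have "1 \<le> (\<Sum>v\<in>D. 2 * decay E D u v)"
      using assms(1,3) that by (auto simp: exp_dominating_iff)
    also have "\<dots> \<le> 2 * (\<Sum>v\<in>insert p D. decay E (insert p D) u v)"
      using weight_insert[OF assms(1,2), of D u p] assms(1,3,4) False that
      by (auto simp: exp_dominating_iff sum_distrib_left[symmetric])
    finally show ?thesis by (simp add: sum_distrib_left)
  qed
  then show ?thesis using assms by (auto simp: exp_dominating_iff)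
qed (use assms in \<open>simp add: insert_absorb\<close>)

lemma graph_del:
  assumes "graph V E"
  shows "graph (del_V V S) (del_E E S)"
  unfolding graph_def
proof
  show "finite (del_V V S)" using assms by (simp add: graph_def del_V_def)
  show "del_E E S \<subseteq> {{u, v} |u v. u \<in> del_V V S \<and> v \<in> del_V V S \<and> u \<noteq> v}"
  proof
    fix e assume e: "e \<in> del_E E S"
    then obtain u v where "e = {u, v}" "u \<in> V" "v \<in> V" "u \<noteq> v"
      using assms by (auto simp: graph_def del_E_def)
    then show "e \<in> {{u, v} |u v. u \<in> del_V V S \<and> v \<in> del_V V S \<and> u \<noteq> v}"
      using e by (auto simp: del_E_def del_V_def)
  qed
qed

text \<open>Makes \<open>x\<close> the only gate: every walk between \<open>S\<close> and the
  remaining vertices has to visit \<open>x\<close>.\<close>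

definition attached :: "'a set \<Rightarrow> 'a set set \<Rightarrow> 'a set \<Rightarrow> 'a \<Rightarrow> bool" where
  "attached V E S x \<longleftrightarrow> S \<subseteq> V \<and> x \<in> V - S \<and> (\<forall>s\<in>S. \<forall>v\<in>V - S. {s, v} \<in> E \<longrightarrow> v = x)"

lemma attached_subset: "attached V E S x \<Longrightarrow> S \<subseteq> V" "attached V E S x \<Longrightarrow> x \<in> V - S"
  by (auto simp: attached_def)

text \<open>The function \<open>c\<close> bounds from below the number of steps from \<open>x\<close> to a vertex of \<open>S\<close>.\<close>

lemma reach_del:
  assumes G: "graph V E" and A: "attached V E S x" and u: "u \<in> V - S"
    and c0: "\<And>s. s \<in> S \<Longrightarrow> {x, s} \<in> E \<Longrightarrow> c s \<le> Suc 0"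
    and c1: "\<And>s t. s \<in> S - D \<Longrightarrow> t \<in> S \<Longrightarrow> {s, t} \<in> E \<Longrightarrow> c t \<le> Suc (c s)"
    and v: "v \<in> reach E D u n"
  shows "(v \<notin> S \<longrightarrow> (\<exists>m\<le>n. v \<in> reach (del_E E S) (D - S) u m)) \<and>
    (v \<in> S \<longrightarrow> x \<notin> D \<and> (\<exists>m. m + c v \<le> n \<and> x \<in> reach (del_E E S) (D - S) u m))"
  using v
proof (induction n arbitrary: v)
  case 0
  then show ?case using u by auto
next
  case (Suc n)
  then obtain y where y: "y \<in> reach E D u n" "y \<notin> D" "{y, v} \<in> E" by auto
  have yv: "y \<in> V" "v \<in> V" using edge_in_V[OF G y(3)] by auto
  have Ad: "w = x" if "s \<in> S" "w \<in> V" "w \<notin> S" "{s, w} \<in> E" for s w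
    using A that by (auto simp: attached_def)
  show ?case
  proof (cases "y \<in> S"; cases "v \<in> S")
    assume "y \<in> S" "v \<in> S"
    then obtain m where "x \<notin> D" "m + c y \<le> n" "x \<in> reach (del_E E S) (D - S) u m"
      using Suc.IH[OF y(1)] by blast
    moreover have "c v \<le> Suc (c y)" using c1 y \<open>y \<in> S\<close> \<open>v \<in> S\<close> by blast
    ultimately show ?thesis using \<open>v \<in> S\<close> by (intro conjI impI) (auto intro!: exI[of _ m])
  next
    \<comment> \<open>The walk leaves \<open>S\<close> and hence returns to \<open>x\<close>. The
      induction hypothesis for \<open>y\<close> already supplies an earlier visit of
      \<open>x\<close> outside \<open>S\<close>, so the detour is cut out.\<close>
    assume S: "y \<in> S" "v \<notin> S"
    then have "v = x" using Ad y yv by blast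
    then show ?thesis using Suc.IH[OF y(1)] S by (metis add_leD1 le_SucI)
  next
    assume S: "y \<notin> S" "v \<in> S"
    then have yx: "y = x" using Ad[of v y] y yv by (simp add: insert_commute)
    obtain m where "m \<le> n" "y \<in> reach (del_E E S) (D - S) u m"
      using Suc.IH[OF y(1)] S by blast
    moreover have "c v \<le> Suc 0" using c0 S(2) y(3) yx by blast
    ultimately have "m + c v \<le> Suc n" "x \<in> reach (del_E E S) (D - S) u m" using yx by auto
    then show ?thesis using S y(2) yx by blast
  next
    assume S: "y \<notin> S" "v \<notin> S"
    obtain m where "m \<le> n" "y \<in> reach (del_E E S) (D - S) u m"
      using Suc.IH[OF y(1)] S by blast
    moreover have "{y, v} \<in> del_E E S" using y(3) S by (auto simp: del_E_def)
    ultimately have "Suc m \<le> Suc n" "v \<in> reach (del_E E S) (D - S) u (Suc m)" using y(2) by auto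
    then show ?thesis using S by blast
  qed
qed

lemma reach_del_subset: "u \<notin> S \<Longrightarrow> reach (del_E E S) (D - S) u n \<subseteq> reach E D u n - S"
  by (induction n) (auto simp: del_E_def)

lemma decay_del:
  assumes "graph V E" "attached V E S x" "u \<in> V - S" "v \<notin> S"
  shows "decay E D u v = decay (del_E E S) (D - S) u v"
  unfolding decay_def
proof (rule antisym; rule first_decay_mono)
  fix n assume "v \<in> reach E D u n"
  then show "\<exists>m\<le>n. v \<in> reach (del_E E S) (D - S) u m"
    using reach_del[OF assms(1-3), where c = "\<lambda>_. 0" and D = D and v = v] assms(4) by auto
next
  fix n assume "v \<in> reach (del_E E S) (D - S) u n"
  then show "\<exists>m\<le>n. v \<in> reach E D u m" using reach_del_subset assms(3) by fastforce
qed

text \<open>A walk into \<open>S\<close> would have to continue from \<open>x\<close>, where it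
  stops. Here \<open>reach_del\<close> is used with \<open>c = 0\<close>, only for its conclusion
  \<open>x \<notin> D\<close>.\<close>

lemma decay_del_blocked:
  assumes "graph V E" "attached V E S x" "u \<in> V - S" "v \<in> S" "x \<in> D"
  shows "decay E D u v = 0"
proof -
  have "v \<notin> reach E D u n" for n
    using reach_del[OF assms(1-3), where c = "\<lambda>_. 0" and D = D and v = v and n = n] assms(4,5) by auto
  then show ?thesis by (simp add: decay_def first_decay_def)
qed

text \<open>The two conditions on \<open>c\<close> along edges make \<open>c v\<close> a lower bound
  for the number of steps from \<open>x\<close> to \<open>v\<close>; the last hypothesis says that
  this many steps suffice.\<close>

lemma decay_del_through:
  assumes "graph V E" "attached V E S x" "u \<in> V - S" "v \<in> S"
    and "\<And>s. s \<in> S \<Longrightarrow> {x, s} \<in> E \<Longrightarrow> c s \<le> Suc 0"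
    and "\<And>s t. s \<in> S - D \<Longrightarrow> t \<in> S \<Longrightarrow> {s, t} \<in> E \<Longrightarrow> c t \<le> Suc (c s)"
    and "\<And>n. x \<in> reach E D u n \<Longrightarrow> v \<in> reach E D u (n + c v)"
  shows "decay E D u v = decay (del_E E S) (D - S) u x * (1/2) ^ c v"
  unfolding decay_def
proof (rule first_decay_shift)
  fix n assume "v \<in> reach E D u n"
  then show "\<exists>m. m + c v \<le> n \<and> x \<in> reach (del_E E S) (D - S) u m"
    using reach_del[where c = c and D = D, OF assms(1-3) assms(5,6)] assms(4) by blast
next
  fix m assume "x \<in> reach (del_E E S) (D - S) u m"
  then show "v \<in> reach E D u (m + c v)" using assms(3,7) reach_del_subset by fastforce
qed

lemma sum_decay_del:
  assumes "graph V E" "attached V E S x" "u \<in> V - S" "finite D"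
  shows "(\<Sum>v\<in>D. 2 * decay E D u v) =
    (\<Sum>v\<in>D - S. 2 * decay (del_E E S) (D - S) u v) + (\<Sum>v\<in>D \<inter> S. 2 * decay E D u v)"
proof -
  have "(\<Sum>v\<in>D. 2 * decay E D u v) =
    (\<Sum>v\<in>D - S. 2 * decay E D u v) + (\<Sum>v\<in>D \<inter> S. 2 * decay E D u v)"
    using assms(4) by (metis add.commute sum.Int_Diff)
  also have "(\<Sum>v\<in>D - S. 2 * decay E D u v) = (\<Sum>v\<in>D - S. 2 * decay (del_E E S) (D - S) u v)"
    using decay_del[OF assms(1-3)] by (intro sum.cong) auto
  finally show ?thesis .
qed

lemma exp_dominating_del_blocked:
  assumes "graph V E" "attached V E S x" "exp_dominating V E D" "x \<in> D"
  shows "exp_dominating (del_V V S) (del_E E S) (D - S)"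
  unfolding exp_dominating_iff[OF graph_del[OF assms(1)]]
proof (intro conjI ballI)
  have D: "D \<subseteq> V" "finite D"
    using assms(1,3) finite_subset by (auto simp: exp_dominating_def graph_def)
  then show "D - S \<subseteq> del_V V S" by (auto simp: del_V_def)
  fix u assume "u \<in> del_V V S - (D - S)"
  then have u: "u \<in> V - S" "u \<notin> D" by (auto simp: del_V_def)
  have "(\<Sum>v\<in>D \<inter> S. 2 * decay E D u v) = 0"
    using decay_del_blocked[OF assms(1,2) u(1) _ assms(4)] by (intro sum.neutral) auto
  moreover have "1 \<le> (\<Sum>v\<in>D. 2 * decay E D u v)"
    using assms(1,3) u by (auto simp: exp_dominating_iff)
  ultimately show "1 \<le> (\<Sum>v\<in>D - S. 2 * decay (del_E E S) (D - S) u v)"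
    using sum_decay_del[OF assms(1,2) u(1) D(2)] by simp
qed

text \<open>Outside \<open>S\<close> the weight is the one in the remaining graph plus nonnegative
  contributions from \<open>D \<inter> S\<close>, so only the vertices of \<open>S\<close> have to
  be checked.\<close>

lemma exp_dominating_extend:
  assumes "graph V E" "attached V E S x" "D \<subseteq> V" "exp_dominating (del_V V S) (del_E E S) (D - S)"
    and "\<And>s. s \<in> S - D \<Longrightarrow> (\<Sum>v\<in>D. 2 * decay E D s v) \<ge> 1"
  shows "exp_dominating V E D"
  unfolding exp_dominating_iff[OF assms(1)]
proof (intro conjI ballI)
  have D: "finite D" using assms(1,3) finite_subset by (auto simp: graph_def)
  fix u assume u: "u \<in> V - D"
  show "(\<Sum>v\<in>D. 2 * decay E D u v) \<ge> 1"
  proof (cases "u \<in> S")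
    case False
    then have "u \<in> del_V V S - (D - S)" using u by (auto simp: del_V_def)
    then have "1 \<le> (\<Sum>v\<in>D - S. 2 * decay (del_E E S) (D - S) u v)"
      using assms(4) exp_dominating_iff[OF graph_del[OF assms(1)]] by blast
    also have "\<dots> \<le> (\<Sum>v\<in>D. 2 * decay E D u v)"
      using sum_decay_del[OF assms(1,2) _ D, of u] u False
      by (simp add: sum_nonneg decay_nonneg)
    finally show ?thesis .
  qed (use u assms(5) in auto)
qed (rule assms(3))

lemma sum_decay_neighbour:
  assumes "finite D" "u \<notin> D" "d \<in> D" "{u, d} \<in> E"
  shows "(\<Sum>v\<in>D. 2 * decay E D u v) \<ge> 1"
proof -
  have "d \<in> reach E D u 1" using assms by simp
  then have "(1/2) ^ 1 \<le> decay E D u d" unfolding decay_def by (rule first_decay_ge)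
  moreover have "2 * decay E D u d \<le> (\<Sum>v\<in>D. 2 * decay E D u v)"
    using assms by (intro member_le_sum) (auto simp: decay_nonneg)
  ultimately show ?thesis by simp
qed

section \<open>The parameter \<open>tau\<close> and pendant paths\<close>

lemma finite_cards:
  assumes "graph V E"
  shows "finite {card D | D. D \<subseteq> V \<and> P D}"
proof -
  have "{card D | D. D \<subseteq> V \<and> P D} \<subseteq> card ` Pow V" by auto
  then show ?thesis using assms finite_subset by (auto simp: graph_def)
qed

lemma gamma_rel_le:
  assumes "graph V E" "dominates_set V E X D"
  shows "gamma_rel V E X \<le> card D"
  unfolding gamma_rel_def using finite_cards[OF assms(1), of "\<lambda>D. \<forall>x\<in>X - D. \<exists>d\<in>D. {x, d} \<in> E"] assms(2)
  by (intro Min_le) (auto simp: dominates_set_def)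

lemma gamma_rel_attained:
  assumes "graph V E" "X \<subseteq> V"
  obtains D where "dominates_set V E X D" "card D = gamma_rel V E X"
proof -
  have "gamma_rel V E X \<in> {card D | D. dominates_set V E X D}"
    unfolding gamma_rel_def
    using finite_cards[OF assms(1), of "\<lambda>D. \<forall>x\<in>X - D. \<exists>d\<in>D. {x, d} \<in> E"] assms(2)
    by (intro Min_in) (auto simp: dominates_set_def)
  then show thesis using that by auto
qed

lemma gamma_eq_gamma_rel: "gamma V E = gamma_rel V E V"
  by (simp add: gamma_def gamma_rel_def dominating_def)

lemma gamma_le: "graph V E \<Longrightarrow> dominating V E D \<Longrightarrow> gamma V E \<le> card D"
  by (simp add: gamma_eq_gamma_rel dominating_def gamma_rel_le)

lemma gamma_attained:
  assumes "graph V E"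
  obtains D where "dominating V E D" "card D = gamma V E"
  using gamma_rel_attained[OF assms order_refl] by (metis gamma_eq_gamma_rel dominating_def)

lemma gamma_e_le:
  assumes "graph V E" "exp_dominating V E D"
  shows "gamma_e V E \<le> card D"
  unfolding gamma_e_def using finite_cards[OF assms(1), of "\<lambda>D. \<forall>u\<in>V. weight V E D u \<ge> 1"] assms(2)
  by (intro Min_le) (auto simp: exp_dominating_def)

lemma gamma_e_attained:
  assumes "graph V E"
  obtains D where "exp_dominating V E D" "card D = gamma_e V E"
proof -
  have "exp_dominating V E V" using assms by (simp add: exp_dominating_iff)
  then have "gamma_e V E \<in> {card D | D. exp_dominating V E D}"
    unfolding gamma_e_def
    using finite_cards[OF assms(1), of "\<lambda>D. \<forall>u\<in>V. weight V E D u \<ge> 1"]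
    by (intro Min_in) (auto simp: exp_dominating_def)
  then show thesis using that by auto
qed

lemma dominating_imp_exp_dominating:
  assumes "graph V E" "dominating V E D"
  shows "exp_dominating V E D"
proof -
  have "finite D" using assms finite_subset
    by (auto simp: graph_def dominating_def dominates_set_def)
  then show ?thesis
    using assms sum_decay_neighbour[of D _ _ E]
    by (fastforce simp: exp_dominating_iff dominating_def dominates_set_def)
qed

lemma gamma_e_le_gamma: "graph V E \<Longrightarrow> gamma_e V E \<le> gamma V E"
  by (metis dominating_imp_exp_dominating gamma_attained gamma_e_le)

abbreviation nbrs :: "'a set set \<Rightarrow> 'a \<Rightarrow> 'a set" where
  "nbrs E x \<equiv> {v. {x, v} \<in> E}"

lemma degree_nbrs:
  assumes "graph V E"
  shows "degree V E x = card (nbrs E x)"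
proof -
  have "{u \<in> V. {x, u} \<in> E} = nbrs E x" using assms by (auto dest: edge_in_V)
  then show ?thesis by (simp add: degree_def)
qed

lemma endvertex_nbrs:
  assumes "graph V E" "endvertex V E y" "{y, x} \<in> E"
  shows "nbrs E y = {x}"
proof (rule sym, rule card_subset_eq)
  show "card {x} = card (nbrs E y)"
    using assms neighbours_finite[OF assms(1), of y] card_mono[of "nbrs E y" "{x}"]
    by (simp add: endvertex_def degree_nbrs[OF assms(1)])
qed (use assms neighbours_finite in auto)

lemma degree2_nbrs:
  assumes "graph V E" "degree V E y = 2" "{y, x} \<in> E" "{y, z} \<in> E" "x \<noteq> z"
  shows "nbrs E y = {x, z}"
  by (rule sym, rule card_subset_eq)
    (use assms neighbours_finite[OF assms(1), of y] in \<open>auto simp: degree_nbrs[OF assms(1)]\<close>)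

lemma card_insert_Diff:
  assumes "finite D" "a \<in> D" "a \<in> S"
  shows "card (insert x (D - S)) \<le> card D"
proof -
  have "card (D - S) \<le> card (D - {a})" using assms by (intro card_mono) auto
  also have "\<dots> = card D - 1" using assms by simp
  finally have "Suc (card (D - S)) \<le> card D" using assms card_gt_0_iff[of D] by fastforce
  then show ?thesis using card_insert_le_m1[of "card D" "D - S" x] by (cases "card D") (auto simp: card_insert_if assms(1))
qed

lemma card_insert_Diff2:
  assumes "finite D" "a \<in> D" "a \<in> S" "b \<in> D" "b \<in> S" "a \<noteq> b"
  shows "card (insert x (D - S)) < card D"
proof -
  have "card (insert x (D - S)) = card (insert x (D - {b} - S))" using assms(5)
    by (intro arg_cong[where f = card]) auto
  also have "\<dots> \<le> card (D - {b})" using assms by (intro card_insert_Diff[of _ a]) auto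
  also have "\<dots> < card D" using assms by (intro card_Diff1_less) auto
  finally show ?thesis .
qed

text \<open>An optimal set that misses \<open>S\<close> can be kept. Otherwise its members in
  \<open>S\<close> are traded for \<open>x\<close>: adding \<open>x\<close> does no harm by
  monotonicity, and then \<open>S\<close> contributes nothing outside.\<close>

lemma gamma_e_del_le:
  assumes "graph V E" "subcubic V E" "attached V E S x"
  shows "gamma_e (del_V V S) (del_E E S) \<le> gamma_e V E"
proof -
  obtain D where D: "exp_dominating V E D" "card D = gamma_e V E"
    using gamma_e_attained[OF assms(1)] .
  have finD: "finite D" using D assms finite_subset by (auto simp: graph_def exp_dominating_def)
  show ?thesis
  proof (cases "D \<inter> S = {}")
    case True
    have "exp_dominating (del_V V S) (del_E E S) (D - S)"
      unfolding exp_dominating_iff[OF graph_del[OF assms(1)]]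
    proof (intro conjI ballI)
      show "D - S \<subseteq> del_V V S" using D by (auto simp: exp_dominating_def del_V_def)
      fix u assume "u \<in> del_V V S - (D - S)"
      then have u: "u \<in> V - S" "u \<in> V - D" by (auto simp: del_V_def)
      then have "1 \<le> (\<Sum>v\<in>D. 2 * decay E D u v)" using D assms(1) by (auto simp: exp_dominating_iff)
      then show "1 \<le> (\<Sum>v\<in>D - S. 2 * decay (del_E E S) (D - S) u v)"
        using sum_decay_del[OF assms(1,3) u(1) finD] True by simp
    qed
    moreover have "D - S = D" using True by auto
    ultimately show ?thesis using gamma_e_le[OF graph_del[OF assms(1)]] D(2) by metis
  next
    case False
    then obtain a where a: "a \<in> D" "a \<in> S" by auto
    have x: "x \<in> V" "x \<notin> S" using assms(3) by (auto simp: attached_def)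
    have "exp_dominating (del_V V S) (del_E E S) (insert x D - S)"
      using exp_dominating_del_blocked[OF assms(1,3) exp_dominating_insert[OF assms(1,2) D(1) x(1)]] by simp
    then have "gamma_e (del_V V S) (del_E E S) \<le> card (insert x D - S)"
      using gamma_e_le[OF graph_del[OF assms(1)]] by blast
    also have "\<dots> \<le> card D" using card_insert_Diff[OF finD a, of x] x(2) by (simp add: insert_Diff_if)
    finally show ?thesis using D by simp
  qed
qed

text \<open>If neither \<open>z\<close> nor \<open>y\<close> were chosen, \<open>z\<close> would receive weight at most \<open>1/2\<close>, even after
  the other neighbour of \<open>y\<close> is added.\<close>

lemma exp_dominating_support:
  assumes G: "graph V E" and C: "subcubic V E" and z: "nbrs E z = {y}" and y: "card (nbrs E y) \<le> 2"
    and D: "exp_dominating V E D"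
  obtains D' where "exp_dominating V E D'" "y \<in> D'" "card D' \<le> card D"
proof -
  have yz: "{z, y} \<in> E" "{y, z} \<in> E" using z by (auto simp: insert_commute)
  have yzV: "y \<in> V" "z \<in> V" "y \<noteq> z" using edge_in_V[OF G yz(1)] by auto
  have finD: "finite D" and DV: "D \<subseteq> V" using D G finite_subset by (auto simp: graph_def exp_dominating_def)
  consider "y \<in> D" | "z \<in> D" "y \<notin> D" | "z \<notin> D" "y \<notin> D" by blast
  then show thesis
  proof cases
    case 1
    then show ?thesis using that D by blast
  next
    case 2
    have A: "attached V E {z} y" using z yzV by (auto simp: attached_def)
    let ?D = "insert y (D - {z})"
    have eq: "insert y D - {z} = ?D" "?D - {z} = ?D" using yzV by auto
    have "exp_dominating (del_V V {z}) (del_E E {z}) (insert y D - {z})"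
      using exp_dominating_del_blocked[OF G A exp_dominating_insert[OF G C D yzV(1)]] by simp
    then have "exp_dominating V E ?D"
      using DV yzV yz(1) finD by (intro exp_dominating_extend[OF G A]) (auto simp: eq intro!: sum_decay_neighbour)
    moreover have "card ?D \<le> card D" using card_insert_Diff[OF finD 2(1)] by simp
    ultimately show ?thesis using that by blast
  next
    case 3
    define X where "X = nbrs E y - {z}"
    have cX: "card X \<le> 1" and finX: "finite X"
      using y neighbours_finite[OF G, of y] yz(2) by (auto simp: X_def)
    \<comment> \<open>By monotonicity \<open>X\<close>, which has at most one element, may be added.
      It then confines all walks from \<open>z\<close> to \<open>{z, y} \<union> X\<close>, and its
      element is at least two steps away: weight at most \<open>2 * (1/4)\<close>.\<close>
    define D2 where "D2 = D \<union> X"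
    have yX: "y \<notin> X" using edge_in_V[OF G, of y y] by (auto simp: X_def)
    have "exp_dominating V E D2"
    proof (cases "X = {}")
      case True
      then show ?thesis using D by (simp add: D2_def)
    next
      case False
      then have "card X = 1" using cX finX by (simp add: le_Suc_eq)
      then obtain x where x: "X = {x}" by (metis card_1_singletonE)
      then have "x \<in> V" using edge_in_V[OF G, of y x] by (auto simp: X_def)
      then show ?thesis using exp_dominating_insert[OF G C D] x by (simp add: D2_def)
    qed
    then have "1 \<le> (\<Sum>v\<in>D2. 2 * decay E D2 z v)"
      using 3 yzV G by (auto simp: exp_dominating_iff D2_def X_def)
    moreover have "decay E D2 z v \<le> (if v \<in> X then 1/4 else 0)" if v: "v \<in> D2" for v
    proof -
      have sub: "reach E D2 z n \<subseteq> {z, y} \<union> X" for n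
      proof (induction n)
        case (Suc n)
        show ?case
        proof
          fix w assume "w \<in> reach E D2 z (Suc n)"
          then obtain t where t: "t \<in> reach E D2 z n" "t \<notin> D2" "{t, w} \<in> E" by auto
          then have "t = z \<or> t = y" using Suc by (auto simp: D2_def)
          then show "w \<in> {z, y} \<union> X" using t(3) z by (auto simp: X_def)
        qed
      qed simp
      have R1: "reach E D2 z (Suc 0) = {y}" using 3 z by (auto simp: D2_def X_def)
      show ?thesis
      proof (cases "v \<in> X")
        case True
        have "2 \<le> n" if n: "v \<in> reach E D2 z n" for n
        proof (rule ccontr)
          assume "\<not> 2 \<le> n"
          then have "n = 0 \<or> n = Suc 0" by auto
          then show False using R1 n True yX by (auto simp: X_def)
        qed
        then have "decay E D2 z v \<le> (1/2)^2" unfolding decay_def by (rule first_decay_le)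
        then show ?thesis using True by (simp add: power2_eq_square)
      next
        case False
        then have "v \<notin> reach E D2 z n" for n using sub[of n] 3 v by (auto simp: D2_def)
        then show ?thesis using False by (simp add: decay_def first_decay_def)
      qed
    qed
    then have "(\<Sum>v\<in>D2. 2 * decay E D2 z v) \<le> (\<Sum>v\<in>D2. 2 * (if v \<in> X then 1/4 else 0))"
      by (intro sum_mono) fastforce
    moreover have "\<dots> = (\<Sum>v\<in>X. 1/2)"
      using finD finX by (intro sum.mono_neutral_cong_right) (auto simp: D2_def)
    ultimately show ?thesis using cX by simp
  qed
qed

lemma connected_decay_pos:
  assumes "connected_graph V E" "u \<in> V" "v \<in> V"
  shows "decay E {} u v > 0"
proof -
  obtain xs where xs: "is_path V E xs" "hd xs = u" "last xs = v"
    using assms unfolding connected_graph_def by blast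
  then have "xs \<noteq> []" by (simp add: is_path_def)
  then have "v \<in> reach E {} u (length xs - 1)"
    using path_imp_reach[of V E xs "{}" "length xs - 1"] xs by (simp add: last_conv_nth)
  then show ?thesis unfolding decay_def by (rule first_decay_pos)
qed

text \<open>Finiteness of the family of candidates \<open>D\<close> makes the infimum in \<open>tau\<close> a minimum.\<close>

lemma tau_le_iff:
  assumes G: "graph V E" and C: "connected_graph V E" and x: "x \<in> V"
  shows "tau V E x \<le> t \<longleftrightarrow> (\<exists>D\<subseteq>V. card D < gamma_e V E \<and> x \<notin> D \<and>
    (\<forall>u\<in>V - D. 1 \<le> (\<Sum>v\<in>D. 2 * decay E D u v) + decay E D u x * t))"
proof -
  define ok where "ok D s \<longleftrightarrow> (\<forall>u\<in>V - D. 1 \<le> (\<Sum>v\<in>D. 2 * decay E D u v) + decay E D u x * s)" for D s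
  define cand where "cand = {D. D \<subseteq> V \<and> card D < gamma_e V E \<and> x \<notin> D}"
  define T where "T = {s. \<exists>D\<in>cand. ok D s}"
  have finV: "finite V" using G by (simp add: graph_def)
  have fin_cand: "finite cand" using finV by (auto simp: cand_def)
  have tau: "tau V E x = Inf T"
    unfolding tau_def T_def
  proof (intro arg_cong[where f = Inf] Collect_cong)
    fix s
    have eq: "weight V E D u + half_pow (dist_G (del_V V D) (del_E E D) x u) * s
       = (\<Sum>v\<in>D. 2 * decay E D u v) + decay E D u x * s" if "u \<in> V - D" "x \<notin> D" for u D
      using weight_out[OF G, of u D] half_pow_dist_G_del[OF G, of u D x] that by simp
    show "(\<exists>D\<subseteq>V. card D < gamma_e V E \<and> x \<notin> D \<and> (\<forall>u\<in>V - D.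
        1 \<le> weight V E D u + half_pow (dist_G (del_V V D) (del_E E D) x u) * s)) = (\<exists>D\<in>cand. ok D s)"
      unfolding Bex_def
    proof (rule ex_cong1)
      fix D
      have "(\<forall>u\<in>V - D. 1 \<le> weight V E D u + half_pow (dist_G (del_V V D) (del_E E D) x u) * s)
        \<longleftrightarrow> ok D s" if "x \<notin> D"
        unfolding ok_def using eq[OF _ that] by (intro ball_cong refl) simp
      then show "(D \<subseteq> V \<and> card D < gamma_e V E \<and> x \<notin> D \<and> (\<forall>u\<in>V - D.
        1 \<le> weight V E D u + half_pow (dist_G (del_V V D) (del_E E D) x u) * s)) = (D \<in> cand \<and> ok D s)"
        unfolding cand_def by blast
    qed
  qed
  \<comment> \<open>A candidate is too small to be exponentially dominating. The vertex of weight
    below 1 forces the tau term to be positive, hence \<open>T\<close> is bounded below by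
    0.\<close>
  have bad: "\<exists>u\<in>V - D. (\<Sum>v\<in>D. 2 * decay E D u v) < 1" if "D \<in> cand" for D
  proof -
    have "\<not> exp_dominating V E D" using that gamma_e_le[OF G, of D] by (auto simp: cand_def)
    then show ?thesis using that by (auto simp: cand_def exp_dominating_iff[OF G] not_le)
  qed
  have "T \<noteq> {}"
  proof -
    have "gamma_e V E \<noteq> 0"
    proof
      assume "gamma_e V E = 0"
      moreover obtain D where "exp_dominating V E D" "card D = gamma_e V E"
        using gamma_e_attained[OF G] .
      ultimately have "exp_dominating V E {}"
        using finV finite_subset[of D V] by (auto simp: exp_dominating_def)
      then show False using x by (auto simp: exp_dominating_iff[OF G])
    qed
    then have "{} \<in> cand" by (simp add: cand_def)
    \<comment> \<open>The empty set is a candidate, and any value above all reciprocals of decays is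
      admissible for it; their sum is a convenient choice.\<close>
    moreover have "ok {} (\<Sum>w\<in>V. 1 / decay E {} w x)"
      unfolding ok_def
    proof
      fix u assume u: "u \<in> V - {}"
      have pos: "decay E {} u x > 0" using connected_decay_pos[OF C] u x by blast
      have "1 / decay E {} u x \<le> (\<Sum>w\<in>V. 1 / decay E {} w x)"
        using u finV by (intro member_le_sum) (auto simp: decay_nonneg)
      then show "1 \<le> (\<Sum>v\<in>{}. 2 * decay E {} u v) + decay E {} u x * (\<Sum>w\<in>V. 1 / decay E {} w x)"
        using pos by (simp add: divide_le_eq mult.commute)
    qed
    ultimately show ?thesis unfolding T_def by blast
  qed
  have "bdd_below T"
  proof (rule bdd_belowI[of _ 0])
    fix s assume "s \<in> T"
    then obtain D where D: "D \<in> cand" "ok D s" by (auto simp: T_def)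
    then obtain u where u: "u \<in> V - D" "(\<Sum>v\<in>D. 2 * decay E D u v) < 1" using bad by blast
    then have "1 \<le> (\<Sum>v\<in>D. 2 * decay E D u v) + decay E D u x * s"
      using D(2) unfolding ok_def by blast
    then have "decay E D u x * s > 0" using u(2) by linarith
    then show "0 \<le> s" using decay_nonneg[of E D u x] by (auto simp: zero_less_mult_iff)
  qed
  have "tau V E x \<le> t \<longleftrightarrow> (\<exists>D\<in>cand. ok D t)"
  proof
    assume "\<exists>D\<in>cand. ok D t"
    then have "t \<in> T" by (simp add: T_def)
    then show "tau V E x \<le> t" unfolding tau using \<open>bdd_below T\<close> by (rule cInf_lower)
  next
    assume le: "tau V E x \<le> t"
    show "\<exists>D\<in>cand. ok D t"
    proof (rule ccontr)
      assume neg: "\<not> (\<exists>D\<in>cand. ok D t)"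
      \<comment> \<open>A candidate that fails at \<open>t\<close> fails up to some bound beyond
        \<open>t\<close>, namely \<open>(1 - a) / h\<close> for a vertex violating its inequality.
        If \<open>h = 0\<close> it fails for every value, and \<open>t + 1\<close> serves. The least
        bound over finitely many candidates keeps the infimum above \<open>t\<close>.\<close>
      have "\<exists>l>t. \<forall>s. ok D s \<longrightarrow> l \<le> s" if "D \<in> cand" for D
      proof -
        have "\<not> ok D t" using neg that by blast
        then obtain u where u: "u \<in> V - D"
          "(\<Sum>v\<in>D. 2 * decay E D u v) + decay E D u x * t < 1" by (auto simp: ok_def not_le)
        define a where "a = (\<Sum>v\<in>D. 2 * decay E D u v)"
        define h where "h = decay E D u x"
        have ok: "1 \<le> a + h * s" if "ok D s" for s using that u by (auto simp: ok_def a_def h_def)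
        have lt: "a + h * t < 1" using u by (simp add: a_def h_def)
        show ?thesis
        proof (cases "h = 0")
          case True
          then have "\<not> ok D s" for s using ok[of s] lt by auto
          then show ?thesis by (intro exI[of _ "t + 1"]) auto
        next
          case False
          then have "h > 0" using decay_nonneg[of E D u x] by (simp add: h_def)
          then have "t < (1 - a) / h" "\<And>s. ok D s \<Longrightarrow> (1 - a) / h \<le> s"
            using lt ok by (auto simp: field_simps)
          then show ?thesis by blast
        qed
      qed
      then obtain f where f: "\<And>D. D \<in> cand \<Longrightarrow> f D > t" "\<And>D s. D \<in> cand \<Longrightarrow> ok D s \<Longrightarrow> f D \<le> s"
        by metis
      define l where "l = Min (insert (t + 1) (f ` cand))"
      have "l > t" using f(1) fin_cand by (auto simp: l_def)
      moreover have "l \<le> Inf T"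
      proof (rule cInf_greatest[OF \<open>T \<noteq> {}\<close>])
        fix s assume "s \<in> T"
        then obtain D where D: "D \<in> cand" "ok D s" by (auto simp: T_def)
        have "l \<le> f D" using D fin_cand by (auto simp: l_def)
        then show "l \<le> s" using f(2)[OF D] by simp
      qed
      ultimately show False using le tau by simp
    qed
  qed
  then show ?thesis by (simp add: cand_def ok_def Bex_def conj_assoc)
qed

text \<open>A pendant part of the graph consists of \<open>S\<close>; the vertex \<open>x\<close> is its
  only contact with the rest, and \<open>y \<in> S\<close> is at distance \<open>c y\<close> from \<open>x\<close> and dominates \<open>S\<close>.\<close>

locale pendant =
  fixes V :: "'a set" and E :: "'a set set" and S :: "'a set" and x y :: 'a and c :: "'a \<Rightarrow> nat"
  assumes G: "graph V E" and C: "subcubic V E" and A: "attached V E S x"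
    and y: "y \<in> S" and dom: "\<And>s. s \<in> S - {y} \<Longrightarrow> {s, y} \<in> E"
    and c0: "\<And>s. s \<in> S \<Longrightarrow> {x, s} \<in> E \<Longrightarrow> c s \<le> Suc 0"
    and c1: "\<And>s t. s \<in> S - {y} \<Longrightarrow> t \<in> S \<Longrightarrow> {s, t} \<in> E \<Longrightarrow> c t \<le> Suc (c s)"
    and through: "\<And>D u n. D \<inter> S = {y} \<Longrightarrow> x \<notin> D \<Longrightarrow> x \<in> reach E D u n \<Longrightarrow> y \<in> reach E D u (n + c y)"
    and support: "\<And>D. exp_dominating V E D \<Longrightarrow>
      \<exists>D'. exp_dominating V E D' \<and> y \<in> D' \<and> card D' \<le> card D"
    and conn: "connected_graph (del_V V S) (del_E E S)"
begin

lemma G': "graph (del_V V S) (del_E E S)"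
  using graph_del[OF G] .

lemma x: "x \<in> V" "x \<notin> S"
  using A by (auto simp: attached_def)

lemma finV: "finite V"
  using G by (simp add: graph_def)

lemma sum_decay_S:
  assumes "D \<subseteq> V" "s \<in> S - D" "y \<in> D"
  shows "1 \<le> (\<Sum>v\<in>D. 2 * decay E D s v)"
  using assms finV finite_subset dom y by (intro sum_decay_neighbour[of _ _ y]) auto

text \<open>Adding \<open>y\<close> to an optimal set of the rest suffices, because \<open>y\<close>
  is adjacent to all other vertices of \<open>S\<close>.\<close>

lemma gamma_e_le_Suc: "gamma_e V E \<le> Suc (gamma_e (del_V V S) (del_E E S))"
proof -
  obtain D where D: "exp_dominating (del_V V S) (del_E E S) D" "card D = gamma_e (del_V V S) (del_E E S)"
    using gamma_e_attained[OF G'] .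
  have DV: "D \<subseteq> V - S" using D by (auto simp: exp_dominating_def del_V_def)
  then have "insert y D - S = D" using y by auto
  then have "exp_dominating V E (insert y D)"
    using D DV y A by (intro exp_dominating_extend[OF G A] sum_decay_S) (auto dest: attached_subset)
  then have "gamma_e V E \<le> card (insert y D)" by (rule gamma_e_le[OF G])
  also have "\<dots> \<le> Suc (card D)" by (rule card_insert_le_m1) auto
  finally show ?thesis using D by simp
qed

text \<open>The only member of \<open>D\<close> in \<open>S\<close> is \<open>y\<close>, and walks
  to it pass \<open>x\<close> and then take \<open>c y\<close> steps. Its contribution is therefore
  the tau term with value \<open>2 * (1/2) ^ c y\<close>.\<close>

lemma exp_dominating_pendant_iff:
  assumes D: "D \<subseteq> V" "D \<inter> S = {y}" "x \<notin> D"
  shows "exp_dominating V E D \<longleftrightarrow> (\<forall>u\<in>del_V V S - (D - S).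
    1 \<le> (\<Sum>v\<in>D - S. 2 * decay (del_E E S) (D - S) u v)
      + decay (del_E E S) (D - S) u x * (2 * (1/2) ^ c y))"
proof -
  have finD: "finite D" using D finV finite_subset by auto
  have yD: "y \<in> D" using D by auto
  have sum_eq: "(\<Sum>v\<in>D. 2 * decay E D u v) = (\<Sum>v\<in>D - S. 2 * decay (del_E E S) (D - S) u v)
      + decay (del_E E S) (D - S) u x * (2 * (1/2) ^ c y)" if u: "u \<in> V - S" for u
  proof -
    have "S - D \<subseteq> S - {y}" using yD by auto
    then have "decay E D u y = decay (del_E E S) (D - S) u x * (1/2) ^ c y"
      using D by (intro decay_del_through[OF G A u y] c0 c1 through) auto
    then show ?thesis using sum_decay_del[OF G A u finD] D(2) by simp
  qed
  have "exp_dominating V E D \<longleftrightarrow> (\<forall>u\<in>V - D. 1 \<le> (\<Sum>v\<in>D. 2 * decay E D u v))"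
    using D(1) by (simp add: exp_dominating_iff[OF G])
  also have "\<dots> \<longleftrightarrow> (\<forall>u\<in>V - S - D. 1 \<le> (\<Sum>v\<in>D. 2 * decay E D u v))"
    using sum_decay_S[OF D(1) _ yD] by blast
  also have "V - S - D = del_V V S - (D - S)" by (auto simp: del_V_def)
  finally show ?thesis using sum_eq by (auto simp: del_V_def)
qed

text \<open>Candidates for tau at this threshold correspond to exponential dominating sets of the
  whole graph that contain \<open>y\<close>, avoid \<open>x\<close> and have no other member in
  \<open>S\<close>. Optimal sets can be brought to this form when \<open>gamma_e\<close> does not
  grow.\<close>

lemma tau_greater_iff:
  "tau (del_V V S) (del_E E S) x > 2 * (1/2) ^ c y \<longleftrightarrow>
    gamma_e V E = Suc (gamma_e (del_V V S) (del_E E S))"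
proof -
  have x': "x \<in> del_V V S" using x by (simp add: del_V_def)
  have "tau (del_V V S) (del_E E S) x \<le> 2 * (1/2) ^ c y \<longleftrightarrow>
    gamma_e V E \<le> gamma_e (del_V V S) (del_E E S)"
  proof
    assume "tau (del_V V S) (del_E E S) x \<le> 2 * (1/2) ^ c y"
    then obtain D where D: "D \<subseteq> del_V V S" "card D < gamma_e (del_V V S) (del_E E S)" "x \<notin> D"
      "\<forall>u\<in>del_V V S - D. 1 \<le> (\<Sum>v\<in>D. 2 * decay (del_E E S) D u v)
        + decay (del_E E S) D u x * (2 * (1/2) ^ c y)"
      unfolding tau_le_iff[OF G' conn x'] by blast
    have "insert y D \<inter> S = {y}" "insert y D - S = D" "insert y D \<subseteq> V" "x \<notin> insert y D"
      using D(1,3) y x attached_subset(1)[OF A] by (auto simp: del_V_def)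
    then have "exp_dominating V E (insert y D)" using exp_dominating_pendant_iff D(4) by simp
    then have "gamma_e V E \<le> card (insert y D)" by (rule gamma_e_le[OF G])
    also have "\<dots> \<le> Suc (card D)" by (rule card_insert_le_m1) auto
    finally show "gamma_e V E \<le> gamma_e (del_V V S) (del_E E S)" using D(2) by simp
  next
    assume le: "gamma_e V E \<le> gamma_e (del_V V S) (del_E E S)"
    obtain D0 where "exp_dominating V E D0" "card D0 = gamma_e V E"
      using gamma_e_attained[OF G] .
    then obtain D where D: "exp_dominating V E D" "y \<in> D"
      "card D \<le> gamma_e (del_V V S) (del_E E S)"
      using support le by (metis order_trans)
    have DV: "D \<subseteq> V" and finD: "finite D"
      using D(1) finV finite_subset by (auto simp: exp_dominating_def)
    have small: "\<not> exp_dominating (del_V V S) (del_E E S) D'" if "card D' < card D" for D'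
      using that gamma_e_le[OF G', of D'] D(3) by linarith
    \<comment> \<open>With \<open>x\<close> chosen, \<open>y\<close> would contribute nothing
      outside \<open>S\<close>, and dropping it would leave a set that is too small for the
      rest.\<close>
    have "x \<notin> D"
    proof
      assume "x \<in> D"
      then have "exp_dominating (del_V V S) (del_E E S) (D - S)"
        using exp_dominating_del_blocked[OF G A D(1)] by blast
      moreover have "card (D - S) < card D" using D(2) y finD by (intro psubset_card_mono) auto
      ultimately show False using small by blast
    qed
    \<comment> \<open>Two members of \<open>S\<close> could be traded for the single vertex
      \<open>x\<close>, again leaving too small a set.\<close>
    moreover have "D \<inter> S = {y}"
    proof (rule ccontr)
      assume "D \<inter> S \<noteq> {y}"
      then obtain b where b: "b \<in> D" "b \<in> S" "y \<noteq> b" using D(2) y by auto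
      have "exp_dominating (del_V V S) (del_E E S) (insert x D - S)"
        using exp_dominating_del_blocked[OF G A exp_dominating_insert[OF G C D(1) x(1)]] by blast
      moreover have "card (insert x D - S) < card D"
        using card_insert_Diff2[OF finD D(2) y b, of x] x(2) by (simp add: insert_Diff_if)
      ultimately show False using small by blast
    qed
    ultimately have "\<forall>u\<in>del_V V S - (D - S). 1 \<le> (\<Sum>v\<in>D - S. 2 * decay (del_E E S) (D - S) u v)
      + decay (del_E E S) (D - S) u x * (2 * (1/2) ^ c y)"
      using exp_dominating_pendant_iff DV D(1) by blast
    moreover have "card (D - S) < card D" using D(2) y finD by (intro psubset_card_mono) auto
    ultimately show "tau (del_V V S) (del_E E S) x \<le> 2 * (1/2) ^ c y"
      unfolding tau_le_iff[OF G' conn x'] using DV D(3) \<open>x \<notin> D\<close>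
      by (intro exI[of _ "D - S"]) (auto simp: del_V_def)
  qed
  then show ?thesis using gamma_e_le_Suc by linarith
qed

lemma gamma_e_del: "gamma_e (del_V V S) (del_E E S) \<le> gamma_e V E"
  using gamma_e_del_le[OF G C A] .

lemma gamma_le_Suc: "gamma V E \<le> Suc (gamma (del_V V S) (del_E E S))"
proof -
  obtain D where D: "dominating (del_V V S) (del_E E S) D" "card D = gamma (del_V V S) (del_E E S)"
    using gamma_attained[OF G'] .
  have "dominating V E (insert y D)"
    using D(1) dom y attached_subset(1)[OF A]
    unfolding dominating_def dominates_set_def del_V_def del_E_def by blast
  then have "gamma V E \<le> card (insert y D)" by (rule gamma_le[OF G])
  also have "\<dots> \<le> Suc (card D)" by (rule card_insert_le_m1) auto
  finally show ?thesis using D by simp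
qed

lemma gamma_eq_extend:
  assumes "gamma (del_V V S) (del_E E S) = gamma_e (del_V V S) (del_E E S)"
    and "tau (del_V V S) (del_E E S) x > 2 * (1/2) ^ c y"
  shows "gamma V E = gamma_e V E"
  using assms gamma_le_Suc gamma_e_le_gamma[OF G] unfolding tau_greater_iff by linarith

lemma gamma_eq_reduce:
  assumes "gamma V E = gamma_e V E" "Suc (gamma (del_V V S) (del_E E S)) \<le> gamma V E"
  shows "gamma (del_V V S) (del_E E S) = gamma_e (del_V V S) (del_E E S)"
    and "tau (del_V V S) (del_E E S) x > 2 * (1/2) ^ c y"
  using assms gamma_e_le_Suc gamma_e_le_gamma[OF G'] unfolding tau_greater_iff by linarith+

end

section \<open>The three operations and longest paths\<close>

lemma nbrs_del: "y \<notin> S \<Longrightarrow> nbrs (del_E E S) y = nbrs E y - S"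
  by (auto simp: del_E_def)

lemma del_del: "del_V (del_V V S) T = del_V V (S \<union> T)" "del_E (del_E E S) T = del_E E (S \<union> T)"
  by (auto simp: del_V_def del_E_def)

lemma is_path_Cons:
  "is_path V E (v # u # xs) \<longleftrightarrow> v \<in> V \<and> v \<notin> set (u # xs) \<and> {v, u} \<in> E \<and> is_path V E (u # xs)"
proof -
  have "(\<forall>i. Suc i < length (v # u # xs) \<longrightarrow> {(v # u # xs) ! i, (v # u # xs) ! Suc i} \<in> E) \<longleftrightarrow>
    {v, u} \<in> E \<and> (\<forall>i. Suc i < length (u # xs) \<longrightarrow> {(u # xs) ! i, (u # xs) ! Suc i} \<in> E)"
    (is "(\<forall>i. ?Q i) \<longleftrightarrow> _")
  proof -
    have "(\<forall>i. ?Q i) \<longleftrightarrow> ?Q 0 \<and> (\<forall>i. ?Q (Suc i))" by (metis not0_implies_Suc)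
    then show ?thesis by simp
  qed
  then show ?thesis unfolding is_path_def by auto
qed

lemma is_path_single: "is_path V E [v] \<longleftrightarrow> v \<in> V"
  by (simp add: is_path_def)

lemma subcubic_del:
  assumes "graph V E" "subcubic V E"
  shows "subcubic (del_V V S) (del_E E S)"
  unfolding subcubic_def
proof
  fix v assume v: "v \<in> del_V V S"
  have "degree (del_V V S) (del_E E S) v \<le> degree V E v"
    unfolding degree_def using assms(1)
    by (intro card_mono) (auto simp: graph_def del_V_def del_E_def)
  then show "degree (del_V V S) (del_E E S) v \<le> 3"
    using assms(2) v by (auto simp: subcubic_def del_V_def)
qed

lemma is_path_del_subset:
  "is_path (del_V V S) (del_E E S) xs \<Longrightarrow> is_path V E xs"
  by (auto simp: is_path_def del_V_def del_E_def)

text \<open>The point is connectedness: an internal vertex of a path has two different neighbours on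
  it, so \<open>y\<close> never lies inside a path between other vertices.\<close>

lemma tree_del_leaf:
  assumes T: "tree V E" and y: "nbrs E y = {x}"
  shows "tree (del_V V {y}) (del_E E {y})"
  unfolding tree_def
proof (intro conjI)
  have G: "graph V E" using T by (simp add: tree_def)
  then show "graph (del_V V {y}) (del_E E {y})" by (rule graph_del)
  have xy: "x \<in> V" "y \<in> V" "x \<noteq> y" using edge_in_V[OF G, of y x] y by auto
  then show "del_V V {y} \<noteq> {}" by (auto simp: del_V_def)
  show "\<nexists>xs. is_cycle (del_V V {y}) (del_E E {y}) xs"
  proof
    assume "\<exists>xs. is_cycle (del_V V {y}) (del_E E {y}) xs"
    then obtain xs where "is_cycle (del_V V {y}) (del_E E {y}) xs" by blast
    then have "is_cycle V E xs"
      unfolding is_cycle_def using is_path_del_subset[of V "{y}" E xs] by (auto simp: del_E_def)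
    then show False using T by (auto simp: tree_def)
  qed
  show "connected_graph (del_V V {y}) (del_E E {y})"
    unfolding connected_graph_def
  proof (intro ballI)
    fix u v assume uv: "u \<in> del_V V {y}" "v \<in> del_V V {y}"
    then obtain xs where xs: "is_path V E xs" "hd xs = u" "last xs = v"
      using T unfolding tree_def connected_graph_def del_V_def by blast
    have "y \<notin> set xs"
    proof
      assume "y \<in> set xs"
      then obtain i where i: "i < length xs" "xs ! i = y" by (auto simp: in_set_conv_nth)
      have "xs \<noteq> []" using xs by (simp add: is_path_def)
      then have ends: "xs ! 0 \<noteq> y" "xs ! (length xs - 1) \<noteq> y"
        using xs uv by (auto simp: hd_conv_nth last_conv_nth del_V_def)
      have "i \<noteq> 0" using ends(1) by (rule contrapos_nn) (use i(2) in simp)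
      moreover have "i \<noteq> length xs - 1" using ends(2) by (rule contrapos_nn) (use i(2) in simp)
      ultimately obtain j where j: "i = Suc j" "Suc i < length xs" using i by (cases i) auto
      then have "{xs ! j, y} \<in> E" "{y, xs ! Suc i} \<in> E" using xs i unfolding is_path_def by auto
      then have "xs ! j \<in> nbrs E y" "xs ! Suc i \<in> nbrs E y" by (simp_all add: insert_commute)
      then have "xs ! j = x" "xs ! Suc i = x" unfolding y by simp_all
      moreover have "xs ! j \<noteq> xs ! Suc i"
        using xs(1) j by (auto simp: is_path_def nth_eq_iff_index_eq)
      ultimately show False by simp
    qed
    then have "\<forall>i<length xs. xs ! i \<noteq> y" by auto
    then have "is_path (del_V V {y}) (del_E E {y}) xs"
      using xs(1) \<open>y \<notin> set xs\<close> by (auto simp: is_path_def del_V_def del_E_def)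
    then show "\<exists>xs. is_path (del_V V {y}) (del_E E {y}) xs \<and> hd xs = u \<and> last xs = v"
      using xs by blast
  qed
qed

lemma tree_del_P2:
  assumes "tree V E" "nbrs E z = {y}" "nbrs E y = {x, z}" "x \<noteq> z"
  shows "tree (del_V V {y, z}) (del_E E {y, z})"
proof -
  have "y \<noteq> z" using assms edge_in_V[of V E y z] by (auto simp: tree_def)
  then have "nbrs (del_E E {z}) y = {x}" using assms nbrs_del[of y "{z}" E] by auto
  from tree_del_leaf[OF tree_del_leaf[OF assms(1,2)] this] show ?thesis
    by (simp add: del_del insert_commute)
qed

lemma tree_del_P3:
  assumes "tree V E" "nbrs E z = {y}" "nbrs E y = {x, z}" "nbrs E x = {w, y}" "x \<noteq> z" "w \<noteq> y" "w \<noteq> z"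
  shows "tree (del_V V {x, y, z}) (del_E E {x, y, z})"
proof -
  have "x \<noteq> y" using assms edge_in_V[of V E y x] by (auto simp: tree_def)
  then have "nbrs (del_E E {y, z}) x = {w}" using assms nbrs_del[of x "{y, z}" E] by auto
  from tree_del_leaf[OF tree_del_P2[OF assms(1,2,3,5)] this] show ?thesis
    by (simp add: del_del insert_commute)
qed

text \<open>Here \<open>c\<close> is the distance from \<open>x\<close>. From \<open>c y = 1\<close>
  the threshold of Operation 2 arises as \<open>2 * (1/2) ^ 1 = 1\<close>.\<close>

lemma pendant_P2:
  assumes T: "tree V E" "subcubic V E" and nb: "nbrs E z = {y}" "nbrs E y = {x, z}" and "x \<noteq> z"
  shows "pendant V E {y, z} x y (\<lambda>s. if s = y then 1 else 2)"
proof
  have edges: "{z, y} \<in> E" "{y, x} \<in> E" "{x, y} \<in> E" using nb by (auto simp: insert_commute)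
  show G: "graph V E" using T by (simp add: tree_def)
  have V: "x \<in> V" "y \<in> V" "z \<in> V" "x \<noteq> y" "y \<noteq> z" using edge_in_V[OF G] edges by blast+
  show "attached V E {y, z} x" using V nb \<open>x \<noteq> z\<close> by (auto simp: attached_def)
  show "y \<in> reach E D u (n + (if y = y then 1 else 2))" if "x \<in> reach E D u n" "x \<notin> D" for D u n
    using that edges by auto
  show "\<exists>D'. exp_dominating V E D' \<and> y \<in> D' \<and> card D' \<le> card D" if "exp_dominating V E D" for D
    using exp_dominating_support[OF G T(2) nb(1) _ that] nb(2) by (metis card_2_iff \<open>x \<noteq> z\<close> order_refl)
  show "connected_graph (del_V V {y, z}) (del_E E {y, z})"
    using tree_del_P2[OF T(1) nb \<open>x \<noteq> z\<close>] by (simp add: tree_def)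
  show "(if s = y then 1 else 2) \<le> Suc 0" if "s \<in> {y, z}" "{x, s} \<in> E" for s
    using that nb V by (auto simp: insert_commute)
qed (use T nb in auto)

text \<open>The attachment vertex, called \<open>x\<close> in the locale, is \<open>w\<close> here,
  and \<open>c\<close> counts the steps from \<open>w\<close>.\<close>

lemma pendant_P3:
  assumes T: "tree V E" "subcubic V E" and nb: "nbrs E z = {y}" "nbrs E y = {x, z}" "nbrs E x = {w, y}"
    and ne: "x \<noteq> z" "w \<noteq> y" "w \<noteq> z"
  shows "pendant V E {x, y, z} w y (\<lambda>s. if s = x then 1 else if s = y then 2 else 3)"
proof
  have edges: "{z, y} \<in> E" "{y, x} \<in> E" "{x, y} \<in> E" "{w, x} \<in> E" using nb by (auto simp: insert_commute)
  show G: "graph V E" using T by (simp add: tree_def)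
  have V: "w \<in> V" "x \<in> V" "y \<in> V" "z \<in> V" "x \<noteq> y" "y \<noteq> z" "w \<noteq> x"
    using edge_in_V[OF G] edges by blast+
  show "attached V E {x, y, z} w" using V nb ne by (auto simp: attached_def)
  show "y \<in> reach E D u (n + (if y = x then 1 else if y = y then 2 else 3))"
    if "w \<in> reach E D u n" "w \<notin> D" "D \<inter> {x, y, z} = {y}" for D u n
  proof -
    have "x \<notin> D" using that(3) V by auto
    moreover have "x \<in> reach E D u (Suc n)" using that edges by auto
    ultimately have "y \<in> reach E D u (Suc (Suc n))" using edges(3) by (subst reach.simps) blast
    then show ?thesis using V by simp
  qed
  show "\<exists>D'. exp_dominating V E D' \<and> y \<in> D' \<and> card D' \<le> card D" if "exp_dominating V E D" for D
    using exp_dominating_support[OF G T(2) nb(1) _ that] nb(2) by (metis card_2_iff ne(1) order_refl)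
  show "connected_graph (del_V V {x, y, z}) (del_E E {x, y, z})"
    using tree_del_P3[OF T(1) nb ne] by (simp add: tree_def)
  show "(if s = x then 1 else if s = y then 2 else 3) \<le> Suc 0" if "s \<in> {x, y, z}" "{w, s} \<in> E" for s
    using that nb V ne by (auto simp: insert_commute)
  show "{s, y} \<in> E" if "s \<in> {x, y, z} - {y}" for s using that edges by auto
  show "(if t = x then 1 else if t = y then 2 else 3) \<le> Suc (if s = x then 1 else if s = y then 2 else 3)"
    if "s \<in> {x, y, z} - {y}" "t \<in> {x, y, z}" "{s, t} \<in> E" for s t
    using that nb V ne by auto
qed (use T in auto)

section \<open>Each operation preserves equality of the two parameters\<close>

lemma tree_single: "tree {v} {}"
proof -
  have "length xs \<le> 1" if "is_path {v} {} xs" for xs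
    using that card_mono[of "{v}" "set xs"] distinct_card[of xs] by (auto simp: is_path_def)
  then have "\<nexists>xs. is_cycle {v} {} xs" by (fastforce simp: is_cycle_def)
  moreover have "connected_graph {v} {}"
    unfolding connected_graph_def by (auto intro!: exI[of _ "[v]"] simp: is_path_single)
  ultimately show ?thesis by (simp add: tree_def graph_def)
qed

lemma gamma_single: "gamma {v} {} = 1" "gamma_e {v} {} = 1"
proof -
  have G: "graph {v} {}" by (simp add: graph_def)
  obtain D where D: "exp_dominating {v} {} D" "card D = gamma_e {v} {}" using gamma_e_attained[OF G] .
  have "D \<noteq> {}" using D(1) by (auto simp: exp_dominating_iff[OF G])
  then have "D = {v}" using D(1) by (auto simp: exp_dominating_def)
  moreover have "gamma {v} {} \<le> card {v}"
    by (rule gamma_le[OF G]) (simp add: dominating_def dominates_set_def)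
  ultimately show "gamma {v} {} = 1" "gamma_e {v} {} = 1" using D(2) gamma_e_le_gamma[OF G] by auto
qed

lemma attached_leaf:
  assumes "graph V E" "nbrs E y = {x}"
  shows "attached V E {y} x"
  using assms edge_in_V[OF assms(1), of y x] by (auto simp: attached_def)

text \<open>The minimum dominating set containing \<open>x\<close> also dominates the new leaf, so
  \<open>gamma\<close> does not grow, while \<open>gamma_e\<close> does not drop.\<close>

lemma op1_gamma_eq:
  assumes G: "graph V E" and C: "subcubic V E" and op: "op1 V E V' E'" and eq: "gamma V' E' = gamma_e V' E'"
  shows "gamma V E = gamma_e V E"
proof -
  obtain x y D where 1: "endvertex V E y" "{x, y} \<in> E" "V' = del_V V {y}" "E' = del_E E {y}"
    "min_dominating V' E' D" "x \<in> D" using op unfolding op1_def by blast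
  have "nbrs E y = {x}" using endvertex_nbrs[OF G 1(1)] 1(2) by (simp add: insert_commute)
  then have "gamma_e V' E' \<le> gamma_e V E"
    using gamma_e_del_le[OF G C attached_leaf[OF G]] 1 by blast
  moreover have "dominating V E D"
    using 1 unfolding min_dominating_def dominating_def dominates_set_def del_V_def del_E_def
    by (auto simp: insert_commute)
  then have "gamma V E \<le> gamma V' E'" using gamma_le[OF G, of D] 1(5) by (simp add: min_dominating_def)
  ultimately show ?thesis using eq gamma_e_le_gamma[OF G] by linarith
qed

lemma op2_gamma_eq:
  assumes T: "tree V E" and C: "subcubic V E" and op: "op2 V E V' E'" and eq: "gamma V' E' = gamma_e V' E'"
  shows "gamma V E = gamma_e V E"
proof -
  obtain x y z where 2: "is_path V E [x, y, z]" "degree V E y = 2" "endvertex V E z"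
    "V' = del_V V {y, z}" "E' = del_E E {y, z}"
    and alt: "tau V' E' x > 1 \<or> gamma_rel V' E' (V' - {x}) < gamma V' E'"
    using op unfolding op2_def by blast
  have G: "graph V E" using T by (simp add: tree_def)
  have e: "{z, y} \<in> E" "{y, x} \<in> E" "{y, z} \<in> E" "x \<noteq> z" "x \<in> V" "y \<in> V" "z \<in> V"
    using 2(1) by (auto simp: is_path_Cons is_path_single insert_commute)
  have nb: "nbrs E z = {y}" "nbrs E y = {x, z}"
    using endvertex_nbrs[OF G 2(3) e(1)] degree2_nbrs[OF G 2(2) e(2-4)] by auto
  interpret pendant V E "{y, z}" x y "\<lambda>s. if s = y then 1 else 2"
    using pendant_P2[OF T C nb e(4)] .
  show ?thesis
    using alt
  proof
    assume "tau V' E' x > 1"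
    then show ?thesis using gamma_eq_extend eq 2(4,5) by simp
  next
    assume less: "gamma_rel V' E' (V' - {x}) < gamma V' E'"
    obtain D where D: "dominates_set V' E' (V' - {x}) D" "card D = gamma_rel V' E' (V' - {x})"
      using gamma_rel_attained[of V' E' "V' - {x}"] G' 2(4,5) by blast
    \<comment> \<open>Only \<open>x\<close> may be undominated by \<open>D\<close> in the smaller
      tree, and \<open>y\<close> takes care of \<open>x\<close> and \<open>z\<close> alike. So
      \<open>gamma\<close> does not grow, and \<open>gamma_e\<close> does not drop.\<close>
    have "dominating V E (insert y D)"
      using D(1) e unfolding dominating_def dominates_set_def 2(4,5) del_V_def del_E_def
      by (auto simp: insert_commute)
    then have "gamma V E \<le> card (insert y D)" by (rule gamma_le[OF G])
    also have "\<dots> \<le> Suc (card D)" by (rule card_insert_le_m1) auto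
    finally show ?thesis using less D(2) eq gamma_e_del gamma_e_le_gamma[OF G] 2(4,5) by simp
  qed
qed

lemma op3_gamma_eq:
  assumes T: "tree V E" and C: "subcubic V E" and op: "op3 V E V' E'" and eq: "gamma V' E' = gamma_e V' E'"
  shows "gamma V E = gamma_e V E"
proof -
  obtain w x y z where 3: "is_path V E [w, x, y, z]" "degree V E x = 2" "degree V E y = 2" "endvertex V E z"
    "V' = del_V V {x, y, z}" "E' = del_E E {x, y, z}" "tau V' E' w > 1/2"
    using op unfolding op3_def by blast
  have G: "graph V E" using T by (simp add: tree_def)
  have e: "{z, y} \<in> E" "{y, x} \<in> E" "{y, z} \<in> E" "{x, w} \<in> E" "{x, y} \<in> E" "x \<noteq> z" "w \<noteq> y" "w \<noteq> z"
    using 3(1) by (auto simp: is_path_Cons is_path_single insert_commute)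
  have nb: "nbrs E z = {y}" "nbrs E y = {x, z}" "nbrs E x = {w, y}"
    using endvertex_nbrs[OF G 3(4) e(1)] degree2_nbrs[OF G 3(3) e(2,3,6)]
      degree2_nbrs[OF G 3(2) e(4,5,7)] by auto
  interpret pendant V E "{x, y, z}" w y "\<lambda>s. if s = x then 1 else if s = y then 2 else 3"
    using pendant_P3[OF T C nb e(6-8)] .
  \<comment> \<open>Lets \<open>c y\<close> evaluate to 2, so that the threshold becomes
    \<open>2 * (1/2) ^ 2 = 1/2\<close>.\<close>
  have "x \<noteq> y" using 3(1) by (auto simp: is_path_Cons)
  then show ?thesis using gamma_eq_extend eq 3(5-7) by (simp add: power2_eq_square)
qed

lemma famT_imp:
  assumes "famT V E"
  shows "tree V E \<and> subcubic V E \<and> gamma V E = gamma_e V E"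
  using assms
proof induction
  case (base v)
  then show ?case by (simp add: tree_single gamma_single subcubic_def degree_def)
next
  case (step V E V' E')
  then have "gamma V E = gamma_e V E"
    using op1_gamma_eq op2_gamma_eq op3_gamma_eq by (metis tree_def)
  then show ?case using step by blast
qed

section \<open>Undoing an operation\<close>

lemma support_or_leaf:
  assumes "dominating V E D" "z \<in> V" "nbrs E z = {y}"
  shows "y \<in> D \<or> z \<in> D"
proof (cases "z \<in> D")
  case False
  then obtain d where "d \<in> D" "d \<in> nbrs E z"
    using assms(1,2) by (auto simp: dominating_def dominates_set_def)
  then show ?thesis using assms(3) by simp
qed simp

lemma dominating_finite: "graph V E \<Longrightarrow> dominating V E D \<Longrightarrow> finite D"
  using finite_subset by (auto simp: graph_def dominating_def dominates_set_def)

text \<open>Both parameters survive the removal of \<open>z\<close>: dominating sets and exponential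
  dominating sets can be made to contain \<open>y\<close>, the former because of the two leaves, the
  latter because of the remaining leaf \<open>z'\<close>.\<close>

lemma op1_reduce:
  assumes G: "graph V E" and C: "subcubic V E" and eq: "gamma V E = gamma_e V E"
    and z: "nbrs E z = {y}" "nbrs E z' = {y}" "z \<noteq> z'"
  shows "op1 V E (del_V V {z}) (del_E E {z}) \<and>
    gamma (del_V V {z}) (del_E E {z}) = gamma_e (del_V V {z}) (del_E E {z})"
proof -
  have e: "{y, z} \<in> E" "{y, z'} \<in> E" using z by (auto simp: insert_commute)
  have V: "y \<in> V" "z \<in> V" "z' \<in> V" "y \<noteq> z" "y \<noteq> z'" using edge_in_V[OF G] e by blast+
  have G': "graph (del_V V {z}) (del_E E {z})" using graph_del[OF G] .
  have A: "attached V E {z} y" using attached_leaf[OF G z(1)] .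
  obtain D where D: "dominating V E D" "card D = gamma V E" using gamma_attained[OF G] .
  have finD: "finite D" using dominating_finite[OF G D(1)] .
  define D1 where "D1 = insert y (D - {y, z, z'})"
  obtain a where "a \<in> D" "a \<in> {y, z, z'}" using support_or_leaf[OF D(1) V(2) z(1)] by auto
  then have card1: "card D1 \<le> gamma V E"
    unfolding D1_def D(2)[symmetric] by (rule card_insert_Diff[OF finD])
  have dom1: "dominating (del_V V {z}) (del_E E {z}) D1"
    unfolding dominating_def dominates_set_def
  proof (intro conjI ballI)
    show "D1 \<subseteq> del_V V {z}" using D(1) V by (auto simp: D1_def dominating_def dominates_set_def del_V_def)
    fix v assume v: "v \<in> del_V V {z} - D1"
    show "\<exists>d\<in>D1. {v, d} \<in> del_E E {z}"
    proof (cases "v = z'")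
      case True
      then show ?thesis using e V z(3) by (auto simp: D1_def del_E_def insert_commute)
    next
      case False
      then have v': "v \<in> V - D" "v \<noteq> y" "v \<noteq> z" using v by (auto simp: D1_def del_V_def)
      then obtain d where d: "d \<in> D" "{v, d} \<in> E"
        using D(1) by (auto simp: dominating_def dominates_set_def)
      then have "v \<in> nbrs E d" by (simp add: insert_commute)
      then have "d \<noteq> z" "d \<noteq> z'" using z v'(2) by auto
      then show ?thesis using d v' by (auto simp: D1_def del_E_def)
    qed
  qed
  obtain D2 where D2: "exp_dominating (del_V V {z}) (del_E E {z}) D2"
    "card D2 = gamma_e (del_V V {z}) (del_E E {z})" using gamma_e_attained[OF G'] .
  have nb': "nbrs (del_E E {z}) z' = {y}" using nbrs_del[of z' "{z}" E] z V by auto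
  \<comment> \<open>Removing \<open>z\<close> costs \<open>y\<close> one of its at most three edges;
    this makes \<open>exp_dominating_support\<close> applicable to the leaf
    \<open>z'\<close>.\<close>
  have "card (nbrs (del_E E {z}) y) \<le> 2"
    using nbrs_del[of y "{z}" E] V(4) e(1) subcubic_neighbours[OF G C V(1)] neighbours_finite[OF G, of y]
    by simp
  then obtain D3 where D3: "exp_dominating (del_V V {z}) (del_E E {z}) D3" "y \<in> D3" "card D3 \<le> card D2"
    using exp_dominating_support[OF G' subcubic_del[OF G C] nb' _ D2(1)] by blast
  have D3V: "D3 \<subseteq> V" "D3 - {z} = D3" using D3(1) by (auto simp: exp_dominating_def del_V_def)
  have "finite D3" using D3V(1) G finite_subset by (auto simp: graph_def)
  then have "exp_dominating V E D3"
    using D3V D3 e by (intro exp_dominating_extend[OF G A])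
      (auto simp: insert_commute intro!: sum_decay_neighbour[of _ _ y])
  then have "gamma_e V E \<le> gamma_e (del_V V {z}) (del_E E {z})"
    using gamma_e_le[OF G] D2(2) D3(3) by fastforce
  then have eqs: "gamma (del_V V {z}) (del_E E {z}) = gamma_e (del_V V {z}) (del_E E {z})"
    "card D1 = gamma (del_V V {z}) (del_E E {z})"
    using card1 eq gamma_le[OF G' dom1] gamma_e_le_gamma[OF G'] by auto
  have "endvertex V E z" using V z by (simp add: endvertex_def degree_nbrs[OF G])
  then show ?thesis
    unfolding op1_def min_dominating_def using eqs dom1 e(1) by (auto simp: D1_def)
qed

lemma gamma_del_P2:
  assumes G: "graph V E" and nb: "nbrs E z = {y}" "nbrs E y = {x, z}"
    and D: "dominating V E D" "x \<in> D \<or> (\<exists>d\<in>D - {y, z}. {x, d} \<in> E)"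
  shows "Suc (gamma (del_V V {y, z}) (del_E E {y, z})) \<le> card D"
proof -
  have zV: "z \<in> V" using edge_in_V[OF G, of z y] nb by auto
  have finD: "finite D" using dominating_finite[OF G D(1)] .
  have "dominating (del_V V {y, z}) (del_E E {y, z}) (D - {y, z})"
    unfolding dominating_def dominates_set_def
  proof (intro conjI ballI)
    show "D - {y, z} \<subseteq> del_V V {y, z}" using D(1) by (auto simp: dominating_def dominates_set_def del_V_def)
    fix v assume v: "v \<in> del_V V {y, z} - (D - {y, z})"
    then have v': "v \<in> V - D" "v \<noteq> y" "v \<noteq> z" by (auto simp: del_V_def)
    show "\<exists>d\<in>D - {y, z}. {v, d} \<in> del_E E {y, z}"
    proof (cases "v = x")
      case True
      then show ?thesis using D(2) v' by (auto simp: del_E_def)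
    next
      case False
      obtain d where d: "d \<in> D" "{v, d} \<in> E"
        using D(1) v' by (auto simp: dominating_def dominates_set_def)
      then have "v \<in> nbrs E d" by (simp add: insert_commute)
      then have "d \<noteq> z" "d \<noteq> y" using nb v' False by auto
      then show ?thesis using d v' by (auto simp: del_E_def)
    qed
  qed
  then have "gamma (del_V V {y, z}) (del_E E {y, z}) \<le> card (D - {y, z})"
    by (rule gamma_le[OF graph_del[OF G]])
  also have "\<dots> < card D"
    using support_or_leaf[OF D(1) zV nb(1)] finD by (intro psubset_card_mono) auto
  finally show ?thesis by simp
qed

text \<open>The branch at \<open>q\<close> ensures that some minimum dominating set takes care of
  \<open>x\<close> without \<open>y\<close>; then \<open>gamma\<close> drops, and the tau condition
  follows from \<open>gamma_eq_reduce\<close>.\<close>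

lemma op2_reduce:
  assumes T: "tree V E" and C: "subcubic V E" and eq: "gamma V E = gamma_e V E"
    and nb: "nbrs E z = {y}" "nbrs E y = {x, z}" "x \<noteq> z"
    and q: "{x, q} \<in> E" "q \<noteq> y" "q \<noteq> z" "nbrs E q = {x} \<or> (\<exists>p. nbrs E p = {q} \<and> p \<noteq> x)"
  shows "op2 V E (del_V V {y, z}) (del_E E {y, z}) \<and>
    gamma (del_V V {y, z}) (del_E E {y, z}) = gamma_e (del_V V {y, z}) (del_E E {y, z})"
proof -
  interpret pendant V E "{y, z}" x y "\<lambda>s. if s = y then 1 else 2"
    using pendant_P2[OF T C nb] .
  have e: "{x, y} \<in> E" "{y, z} \<in> E" using nb by (auto simp: insert_commute)
  have V: "x \<in> V" "y \<in> V" "z \<in> V" "x \<noteq> y" "y \<noteq> z" "q \<in> V" "x \<noteq> q"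
    using edge_in_V[OF G] e q(1) by blast+
  obtain D where D: "dominating V E D" "card D = gamma V E" using gamma_attained[OF G] .
  have finD: "finite D" using dominating_finite[OF G D(1)] .
  have less: "Suc (gamma (del_V V {y, z}) (del_E E {y, z})) \<le> gamma V E"
    using q(4)
  proof
    assume "nbrs E q = {x}"
    then have "x \<in> D \<or> q \<in> D" using support_or_leaf[OF D(1) V(6)] by blast
    then show ?thesis using gamma_del_P2[OF G nb(1,2) D(1)] q D(2) by auto
  next
    assume "\<exists>p. nbrs E p = {q} \<and> p \<noteq> x"
    then obtain p where p: "nbrs E p = {q}" "p \<noteq> x" by blast
    have pq: "{q, p} \<in> E" using p by (auto simp: insert_commute)
    have pV: "p \<in> V" "p \<noteq> q" using edge_in_V[OF G pq] by auto
    have some: "q \<in> D \<or> p \<in> D" using support_or_leaf[OF D(1) pV(1) p(1)] .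
    \<comment> \<open>The leaf \<open>p\<close> forces \<open>q\<close> or \<open>p\<close> into
      \<open>D\<close>; choosing \<open>q\<close> instead costs nothing and dominates
      \<open>x\<close>.\<close>
    define D' where "D' = insert q (D - {q, p})"
    have "dominating V E D'"
      unfolding dominating_def dominates_set_def
    proof (intro conjI ballI)
      show "D' \<subseteq> V" using D(1) V by (auto simp: D'_def dominating_def dominates_set_def)
      fix v assume v: "v \<in> V - D'"
      show "\<exists>d\<in>D'. {v, d} \<in> E"
      proof (cases "v = p")
        case True
        then show ?thesis using pq by (auto simp: D'_def insert_commute)
      next
        case False
        then have v': "v \<in> V - D" "v \<noteq> q" using v by (auto simp: D'_def)
        then obtain d where d: "d \<in> D" "{v, d} \<in> E"
          using D(1) by (auto simp: dominating_def dominates_set_def)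
        then have "v \<in> nbrs E d" by (simp add: insert_commute)
        then have "d \<noteq> p" using p v' by auto
        then show ?thesis using d by (auto simp: D'_def)
      qed
    qed
    moreover have "card D' \<le> card D"
      unfolding D'_def using some finD card_insert_Diff[of D q "{q, p}" q] card_insert_Diff[of D p "{q, p}" q]
      by auto
    ultimately show ?thesis
      using gamma_del_P2[OF G nb(1,2), of D'] q D(2) by (force simp: D'_def)
  qed
  have "is_path V E [x, y, z]" using e V nb(3) by (simp add: is_path_Cons is_path_single)
  moreover have "degree V E y = 2" "endvertex V E z"
    using nb V by (auto simp: degree_nbrs[OF G] endvertex_def)
  moreover have "tau (del_V V {y, z}) (del_E E {y, z}) x > 1" using gamma_eq_reduce(2)[OF eq less] by simp
  ultimately have "op2 V E (del_V V {y, z}) (del_E E {y, z})" unfolding op2_def by blast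
  then show ?thesis using gamma_eq_reduce(1)[OF eq less] by blast
qed

lemma op3_reduce:
  assumes T: "tree V E" and C: "subcubic V E" and eq: "gamma V E = gamma_e V E"
    and nb: "nbrs E z = {y}" "nbrs E y = {x, z}" "nbrs E x = {w, y}" and ne: "x \<noteq> z" "w \<noteq> y" "w \<noteq> z"
  shows "op3 V E (del_V V {x, y, z}) (del_E E {x, y, z}) \<and>
    gamma (del_V V {x, y, z}) (del_E E {x, y, z}) = gamma_e (del_V V {x, y, z}) (del_E E {x, y, z})"
proof -
  let ?S = "{x, y, z}"
  interpret pendant V E ?S w y "\<lambda>s. if s = x then 1 else if s = y then 2 else 3"
    using pendant_P3[OF T C nb ne] .
  have e: "{x, y} \<in> E" "{y, z} \<in> E" "{w, x} \<in> E" using nb by (auto simp: insert_commute)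
  have V: "x \<in> V" "y \<in> V" "z \<in> V" "x \<noteq> y" "y \<noteq> z" "w \<in> V" "w \<noteq> x"
    using edge_in_V[OF G] e by blast+
  obtain D where D: "dominating V E D" "card D = gamma V E" using gamma_attained[OF G] .
  have finD: "finite D" using dominating_finite[OF G D(1)] .
  have some: "y \<in> D \<or> z \<in> D" using support_or_leaf[OF D(1) V(3) nb(1)] .
  \<comment> \<open>Outside the path \<open>x\<close> dominates only \<open>w\<close>, so
    \<open>w\<close> may replace it. The size still drops, since \<open>y\<close> or
    \<open>z\<close> is discarded together with \<open>x\<close>.\<close>
  define D1 where "D1 = (if x \<in> D then insert w (D - ?S) else D - ?S)"
  have "dominating (del_V V ?S) (del_E E ?S) D1"
    unfolding dominating_def dominates_set_def
  proof (intro conjI ballI)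
    show "D1 \<subseteq> del_V V ?S"
      using D(1) V ne by (auto simp: D1_def dominating_def dominates_set_def del_V_def)
    fix v assume v: "v \<in> del_V V ?S - D1"
    then have v': "v \<in> V - D" "v \<notin> ?S" "x \<in> D \<Longrightarrow> v \<noteq> w" by (auto simp: D1_def del_V_def split: if_splits)
    obtain d where d: "d \<in> D" "{v, d} \<in> E"
      using D(1) v' by (auto simp: dominating_def dominates_set_def)
    then have "v \<in> nbrs E d" by (simp add: insert_commute)
    then have "d \<notin> ?S" using nb v' d(1) by auto
    then show "\<exists>d\<in>D1. {v, d} \<in> del_E E ?S" using d v' by (auto simp: D1_def del_E_def)
  qed
  then have "gamma (del_V V ?S) (del_E E ?S) \<le> card D1" by (rule gamma_le[OF G'])
  also have "\<dots> < card D"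
  proof (cases "x \<in> D")
    case True
    then show ?thesis
      using some V ne card_insert_Diff2[OF finD, of x ?S y w] card_insert_Diff2[OF finD, of x ?S z w]
      by (auto simp: D1_def)
  next
    case False
    then show ?thesis using some finD by (auto simp: D1_def intro!: psubset_card_mono)
  qed
  finally have less: "Suc (gamma (del_V V ?S) (del_E E ?S)) \<le> gamma V E" using D(2) by simp
  have "is_path V E [w, x, y, z]" using e V ne by (simp add: is_path_Cons is_path_single)
  moreover have "degree V E x = 2" "degree V E y = 2" "endvertex V E z"
    using nb V ne by (auto simp: degree_nbrs[OF G] endvertex_def)
  moreover have "tau (del_V V ?S) (del_E E ?S) w > 1/2"
    using gamma_eq_reduce(2)[OF eq less] V by (simp add: power2_eq_square)
  ultimately have "op3 V E (del_V V ?S) (del_E E ?S)" unfolding op3_def by blast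
  then show ?thesis using gamma_eq_reduce(1)[OF eq less] by blast
qed

section \<open>Longest paths in a tree\<close>

lemma tree_no_chord:
  assumes T: "tree V E" and xs: "is_path V E xs" and ij: "Suc i < j" "j < length xs"
  shows "{xs ! i, xs ! j} \<notin> E"
proof
  assume chord: "{xs ! i, xs ! j} \<in> E"
  \<comment> \<open>The segment between the two positions has at least three vertices because
    \<open>Suc i < j\<close>, so the chord closes it to a cycle.\<close>
  define ys where "ys = take (Suc j - i) (drop i xs)"
  have len: "length ys = Suc j - i" using ij by (auto simp: ys_def)
  have nth: "ys ! k = xs ! (i + k)" if "k < Suc j - i" for k using that ij by (auto simp: ys_def)
  have "set ys \<subseteq> set xs" unfolding ys_def by (meson order_trans set_drop_subset set_take_subset)
  then have "is_path V E ys"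
    using xs ij len nth by (auto simp: is_path_def ys_def)
  moreover have "hd ys = xs ! i" "last ys = xs ! j"
    using len nth[of 0] nth[of "j - i"] ij by (auto simp: hd_conv_nth last_conv_nth simp flip: length_greater_0_conv)
  ultimately have "is_cycle V E ys" using chord len ij by (auto simp: is_cycle_def insert_commute)
  then show False using T by (auto simp: tree_def)
qed

definition longest_path :: "'a set \<Rightarrow> 'a set set \<Rightarrow> 'a list \<Rightarrow> bool" where
  "longest_path V E xs \<longleftrightarrow> is_path V E xs \<and> (\<forall>ys. is_path V E ys \<longrightarrow> length ys \<le> length xs)"

lemma longest_path_exists:
  assumes "tree V E"
  obtains xs where "longest_path V E xs"
proof -
  obtain v where "v \<in> V" using assms by (auto simp: tree_def)
  then have "is_path V E [v]" by (simp add: is_path_single)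
  moreover have "length ys < Suc (card V)" if "is_path V E ys" for ys
    using that assms card_mono[of V "set ys"] distinct_card[of ys]
    by (auto simp: is_path_def tree_def graph_def)
  ultimately obtain xs where "is_path V E xs" "\<forall>ys. is_path V E ys \<longrightarrow> length ys \<le> length xs"
    using ex_has_greatest_nat[of "is_path V E" "[v]" length "Suc (card V)"] by auto
  then show thesis using that by (auto simp: longest_path_def)
qed

text \<open>Another neighbour of \<open>z\<close> would either extend the path or, if it lies on the
  path, be the end of a chord.\<close>

lemma longest_path_hd_nbrs:
  assumes T: "tree V E" and L: "longest_path V E (z # y # xs)"
  shows "nbrs E z = {y}"
proof -
  have P: "is_path V E (z # y # xs)" using L by (simp add: longest_path_def)
  have G: "graph V E" using T by (simp add: tree_def)
  have "v = y" if v: "{z, v} \<in> E" for v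
  proof -
    have vV: "v \<in> V" "v \<noteq> z" using edge_in_V[OF G v] by auto
    have "v \<in> set (z # y # xs)"
    proof (rule ccontr)
      assume "v \<notin> set (z # y # xs)"
      then have "is_path V E (v # z # y # xs)"
        using P v vV by (subst is_path_Cons) (auto simp: insert_commute)
      then show False using L by (force simp: longest_path_def)
    qed
    then obtain j where j: "j < length (z # y # xs)" "(z # y # xs) ! j = v"
      by (metis in_set_conv_nth)
    have "\<not> Suc 0 < j" using tree_no_chord[OF T P, of 0 j] j v by auto
    then have "j = 0 \<or> j = 1" by auto
    then show ?thesis using j vV by auto
  qed
  moreover have "{z, y} \<in> E" using P by (simp add: is_path_Cons)
  ultimately show ?thesis by blast
qed

lemma longest_path_replace_hd:
  assumes T: "tree V E" and L: "longest_path V E (z # y # xs)"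
    and v: "{y, v} \<in> E" "xs = [] \<or> v \<noteq> hd xs"
  shows "longest_path V E (v # y # xs)"
proof -
  have G: "graph V E" using T by (simp add: tree_def)
  have P: "is_path V E (y # xs)" using L by (auto simp: longest_path_def is_path_Cons)
  have vV: "v \<in> V" "v \<noteq> y" using edge_in_V[OF G v(1)] by auto
  have "v \<notin> set xs"
  proof
    assume "v \<in> set xs"
    then obtain j where j: "j < length xs" "xs ! j = v" by (metis in_set_conv_nth)
    then have "j \<noteq> 0" using v(2) by (cases xs; cases "j = 0") auto
    then show False using tree_no_chord[OF T P, of 0 "Suc j"] j v(1) by auto
  qed
  then have "is_path V E (v # y # xs)" using vV P v(1) by (auto simp: is_path_Cons insert_commute)
  then show ?thesis using L by (auto simp: longest_path_def)
qed

text \<open>Exchanges the first two vertices for another branch at \<open>x\<close> without changing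
  the length, so that \<open>longest_path_hd_nbrs\<close> also applies to \<open>p\<close>.\<close>

lemma longest_path_replace_branch:
  assumes T: "tree V E" and L: "longest_path V E (z # y # x # xs)"
    and q: "{x, q} \<in> E" "q \<noteq> y" "xs = [] \<or> q \<noteq> hd xs" and p: "{q, p} \<in> E" "p \<noteq> x"
  shows "longest_path V E (p # q # x # xs)"
proof -
  have G: "graph V E" using T by (simp add: tree_def)
  have P: "is_path V E (x # xs)" using L by (auto simp: longest_path_def is_path_Cons)
  have V: "q \<in> V" "p \<in> V" "q \<noteq> x" "p \<noteq> q" using edge_in_V[OF G] q(1) p(1) by blast+
  have "q \<notin> set xs"
  proof
    assume "q \<in> set xs"
    then obtain j where j: "j < length xs" "xs ! j = q" by (metis in_set_conv_nth)
    then have "j \<noteq> 0" using q(3) by (cases xs; cases "j = 0") auto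
    then show False using tree_no_chord[OF T P, of 0 "Suc j"] j q(1) by auto
  qed
  then have Q: "is_path V E (q # x # xs)" using V P q(1) by (auto simp: is_path_Cons insert_commute)
  have "p \<notin> set xs"
  proof
    assume "p \<in> set xs"
    then obtain j where j: "j < length xs" "xs ! j = p" by (metis in_set_conv_nth)
    then show False using tree_no_chord[OF T Q, of 0 "Suc (Suc j)"] p(1) by auto
  qed
  then have "is_path V E (p # q # x # xs)" using V Q p by (auto simp: is_path_Cons insert_commute)
  then show ?thesis using L by (auto simp: longest_path_def)
qed

lemma longest_path_rev: "longest_path V E (rev xs) = longest_path V E xs"
  by (simp add: longest_path_def is_path_rev)

text \<open>The first vertices \<open>z\<close>, \<open>y\<close>, \<open>x\<close>, \<open>w\<close> of a longest path determine the last operation: two leaves at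
  one vertex allow Operation 1; otherwise \<open>y\<close> has degree 2, and Operation 3 applies if \<open>x\<close> has
  degree 2, Operation 2 if \<open>x\<close> has a third neighbour.\<close>

lemma reduce:
  assumes T: "tree V E" and C: "subcubic V E" and eq: "gamma V E = gamma_e V E"
  shows "(\<exists>v. V = {v} \<and> E = {}) \<or> (\<exists>V' E'. (op1 V E V' E' \<or> op2 V E V' E' \<or> op3 V E V' E') \<and>
    V' \<subset> V \<and> tree V' E' \<and> subcubic V' E' \<and> gamma V' E' = gamma_e V' E')"
    (is "?single \<or> ?red")
proof -
  have G: "graph V E" using T by (simp add: tree_def)
  have C': "subcubic (del_V V S) (del_E E S)" for S using subcubic_del[OF G C] .
  have sub: "del_V V S \<subset> V" if "s \<in> S" "s \<in> V" for s S using that by (auto simp: del_V_def)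
  have red1: ?red if "nbrs E z = {y}" "nbrs E z' = {y}" "z \<noteq> z'" for y z z'
  proof -
    have "z \<in> V" using edge_in_V[OF G, of z y] that(1) by auto
    then show ?thesis
      using op1_reduce[OF G C eq that] tree_del_leaf[OF T that(1)] C'[of "{z}"] sub[of z "{z}"] by blast
  qed
  obtain xs where L: "longest_path V E xs" using longest_path_exists[OF T] .
  then have P: "is_path V E xs" by (simp add: longest_path_def)
  show ?thesis
  proof (cases xs)
    case xs': (Cons z xs')
    show ?thesis
    proof (cases xs')
      case Nil
      then have z: "z \<in> V" using P xs' by (simp add: is_path_single)
      have "V = {z}"
      proof (rule ccontr)
        assume "V \<noteq> {z}"
        then obtain v where v: "v \<in> V" "v \<noteq> z" using z by auto
        then obtain ys where ys: "is_path V E ys" "hd ys = z" "last ys = v"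
          using T z unfolding tree_def connected_graph_def by blast
        then have "length ys \<le> 1" "ys \<noteq> []"
          using L xs' Nil by (auto simp: longest_path_def is_path_def)
        then show False using ys v by (cases ys) auto
      qed
      moreover have "E = {}" using G calculation by (auto simp: graph_def)
      ultimately show ?thesis by blast
    next
      case (Cons y r)
      note L = L[unfolded xs' Cons] and P = P[unfolded xs' Cons]
      have nz: "nbrs E z = {y}" using longest_path_hd_nbrs[OF T L] .
      have yz: "{y, z} \<in> E" "y \<noteq> z" "y \<in> V" "z \<in> V"
        using P by (cases r; auto simp: is_path_Cons is_path_single insert_commute)+
      show ?thesis
      proof (cases r)
        case Nil
        show ?thesis
        proof (cases "nbrs E y = {z}")
          case True
          \<comment> \<open>A longest path has two vertices, so any third vertex would be a
            neighbour of \<open>z\<close>. The tree is a single edge and arises from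
            \<open>P_1\<close> by Operation 1.\<close>
          have "V = {y, z}"
          proof (rule ccontr)
            assume "V \<noteq> {y, z}"
            then obtain v where v: "v \<in> V" "v \<noteq> y" "v \<noteq> z" using yz by auto
            then obtain ys where ys: "is_path V E ys" "hd ys = z" "last ys = v"
              using T yz unfolding tree_def connected_graph_def by blast
            then have "length ys \<le> 2" using L Nil by (auto simp: longest_path_def)
            moreover obtain a b ys' where "ys = a # b # ys'"
              using ys v by (metis is_path_def last.simps list.exhaust list.sel(1))
            ultimately have "ys = [z, v]" using ys by auto
            then show False using ys(1) nz v by (auto simp: is_path_Cons)
          qed
          then have V': "del_V V {z} = {y}" using yz by (auto simp: del_V_def)
          have "graph {y} (del_E E {z})" using graph_del[OF G, of "{z}"] V' by simp
          then have E': "del_E E {z} = {}" by (auto simp: graph_def)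
          have "endvertex V E z" using yz nz by (simp add: endvertex_def degree_nbrs[OF G])
          moreover have "min_dominating {y} {} {y}"
            by (simp add: min_dominating_def gamma_single dominating_def dominates_set_def)
          ultimately have "op1 V E {y} {}" unfolding op1_def using V' E' yz(1) by auto
          moreover have "{y} \<subset> V" using yz by auto
          ultimately show ?thesis using tree_single[of y] gamma_single[of y] C'[of "{z}"] V' E'
            by (metis (no_types))
        next
          case False
          then obtain v where v: "{y, v} \<in> E" "v \<noteq> z" using yz by auto
          have "nbrs E v = {y}"
            using longest_path_hd_nbrs[OF T longest_path_replace_hd[OF T L v(1)]] Nil by blast
          then show ?thesis using red1[OF nz _ v(2)[symmetric]] by blast
        qed
      next
        case (Cons x r')
        note L = L[unfolded Cons] and P = P[unfolded Cons]
        have xy: "{y, x} \<in> E" "{x, y} \<in> E" "x \<noteq> y" "x \<noteq> z" "x \<in> V"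
          using P by (cases r'; auto simp: is_path_Cons is_path_single insert_commute)+
        show ?thesis
        proof (cases "nbrs E y = {x, z} \<and> nbrs E x \<noteq> {y}")
          case False
          \<comment> \<open>The second leaf at \<open>y\<close> is \<open>x\<close> itself or a
            third neighbour of \<open>y\<close>, which can take the place of \<open>z\<close> at the
            head of a longest path.\<close>
          have "\<exists>v. nbrs E v = {y} \<and> v \<noteq> z"
          proof (cases "nbrs E x = {y}")
            case False
            then obtain v where v: "{y, v} \<in> E" "v \<noteq> z" "v \<noteq> x"
              using \<open>\<not> (nbrs E y = {x, z} \<and> nbrs E x \<noteq> {y})\<close> yz xy by auto
            then show ?thesis
              using longest_path_hd_nbrs[OF T longest_path_replace_hd[OF T L v(1)]] by auto
          qed (use xy in blast)
          then show ?thesis using red1[OF nz] by metis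
        next
          case True
          then have ny: "nbrs E y = {x, z}" by blast
          \<comment> \<open>If the path ended in \<open>x\<close>, reversing it would show
            \<open>x\<close> to be a leaf.\<close>
          have "r' \<noteq> []"
          proof
            assume "r' = []"
            then have "longest_path V E [x, y, z]" using L longest_path_rev[of V E "[z, y, x]"] by simp
            from longest_path_hd_nbrs[OF T this] show False using True by blast
          qed
          then obtain w r'' where r': "r' = w # r''" by (cases r') auto
          note L = L[unfolded r'] and P = P[unfolded r']
          have w: "{x, w} \<in> E" "w \<noteq> y" "w \<noteq> z"
            using P by (cases r''; auto simp: is_path_Cons is_path_single)+
          show ?thesis
          proof (cases "nbrs E x = {w, y}")
            case nx: True
            show ?thesis
              using op3_reduce[OF T C eq nz ny nx xy(4) w(2,3)] tree_del_P3[OF T nz ny nx xy(4) w(2,3)]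
                C'[of "{x, y, z}"] sub[of z "{x, y, z}"] yz(4) by blast
          next
            case False
            then obtain q where q: "{x, q} \<in> E" "q \<noteq> w" "q \<noteq> y" using xy w by auto
            have qz: "q \<noteq> z"
            proof
              assume "q = z"
              then have "x \<in> nbrs E z" using q(1) by (simp add: insert_commute)
              then show False using nz xy(3) by auto
            qed
            \<comment> \<open>If \<open>q\<close> has a further neighbour \<open>p\<close>, the
              branch through \<open>q\<close> and \<open>p\<close> replaces \<open>y\<close> and
              \<open>z\<close> in the longest path, so \<open>p\<close> is a leaf. This is what
              \<open>op2_reduce\<close> asks of \<open>q\<close>.\<close>
            have "nbrs E q = {x} \<or> (\<exists>p. nbrs E p = {q} \<and> p \<noteq> x)"
            proof (cases "nbrs E q = {x}")
              case False
              moreover have "{q, x} \<in> E" using q(1) by (simp add: insert_commute)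
              ultimately obtain p where p: "{q, p} \<in> E" "p \<noteq> x" by auto
              have "longest_path V E (p # q # x # w # r'')"
                using longest_path_replace_branch[OF T L q(1,3) _ p] q(2) by simp
              from longest_path_hd_nbrs[OF T this] show ?thesis using p(2) by blast
            qed blast
            then show ?thesis
              using op2_reduce[OF T C eq nz ny xy(4) q(1,3) qz] tree_del_P2[OF T nz ny xy(4)]
                C'[of "{y, z}"] sub[of z "{y, z}"] yz(4) by blast
          qed
        qed
      qed
    qed
  qed (use P in \<open>auto simp: is_path_def\<close>)
qed

lemma gamma_eq_imp_famT:
  assumes "tree V E" "subcubic V E" "gamma V E = gamma_e V E"
  shows "famT V E"
  using assms
proof (induction "card V" arbitrary: V E rule: less_induct)
  case less
  then consider v where "V = {v}" "E = {}" | V' E' where "op1 V E V' E' \<or> op2 V E V' E' \<or> op3 V E V' E'"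
    "V' \<subset> V" "tree V' E'" "subcubic V' E'" "gamma V' E' = gamma_e V' E'"
    using reduce by metis
  then show ?case
  proof cases
    case 1
    then show ?thesis by (simp add: famT.base)
  next
    case 2
    have "finite V" using less.prems(1) by (simp add: tree_def graph_def)
    then have "card V' < card V" using 2(2) by (rule psubset_card_mono)
    then have "famT V' E'" using less.hyps 2(3-5) by blast
    then show ?thesis using famT.step[OF less.prems(1,2)] 2(1) by blast
  qed
qed

theorem theorem1:
  fixes V :: "'a set" and E :: "'a set set"
  assumes "tree V E" and "subcubic V E"
  shows "gamma V E = gamma_e V E \<longleftrightarrow> famT V E"
  using gamma_eq_imp_famT[OF assms] famT_imp by blast

end
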